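(* Let $\phi:\mathbb{R}^m\to\overline{\mathbb{R}}$ satisfy (A1)--(A5) of the context. Let $f:\mathbb{R}^m\to\overline{\mathbb{R}}$ be proper, lower semicontinuous and $\phi$-prox-bounded with threshold $\lambda_f$. Let $\bar v\in\bar z+\operatorname{dom}\phi$. Then for any $\lambda\in(0,\lambda_f)$ sufficiently small and $f$ finite and prox-regular at $\bar z$ for $\bar y\in\partial f(\bar z)$ with $$\bar y=\frac1\lambda\nabla\phi(\bar v-\bar z),$$ the following statements hold true: (i) $P_\lambda^\phi f$ is a single-valued, Lipschitz map near $\bar v$ such that $\bar z=P_\lambda^\phi f(\bar v)$ and $$P_\lambda^\phi f(v)=(I+\nabla\phi^*\circ\lambda T)^{-1}(v),$$ where $T$ is the $f$-attentive $\epsilon$-localization of $\partial f$ near $(\bar z,\bar y)$, i.e. the set-valued mapping $T:\mathbb{R}^m\rightrightarrows\mathbb{R}^m$ defined by $T(z):=\{y\in\partial f(z):\|y-\bar y\|<\epsilon\}$ if $\|z-\bar z\|<\epsilon$ and $f(z)<f(\bar z)+\epsilon$, and $T(z):=\emptyset$ otherwise (for some $\epsilon>0$). (ii) $e_\lambda^\phi f$ is Lipschitz differentiable around $\bar v$ with $$\nabla e_\lambda^\phi f(v)=\frac1\lambda\nabla\phi(v-z),\qquad z=P_\lambda^\phi f(v).$$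
   Context: $\overline{\mathbb{R}}=\mathbb{R}\cup\{+\infty,-\infty\}$; $\operatorname{dom}f=\{z:f(z)<\infty\}$; lsc means lower semicontinuous. $f$ is proper if $f>-\infty$ everywhere and $f(z)<\infty$ for some $z$. $I$ is the identity, $\phi^*(y)=\sup_w\langle y,w\rangle-\phi(w)$ is the convex conjugate of $\phi$, and the inverse in (i) is that of a set-valued mapping. A function is Lipschitz differentiable (around a point) if it is differentiable with Lipschitz continuous gradient (on a neighborhood of that point). Legendre functions: a proper convex lsc $\phi$ is essentially smooth if $\operatorname{int}\operatorname{dom}\phi\neq\emptyset$ and $\phi$ is differentiable on $\operatorname{int}\operatorname{dom}\phi$ such that $\|\nabla\phi(w^\nu)\|\to\infty$ whenever $w^\nu\to w\in\operatorname{bdry}\operatorname{dom}\phi$; essentially strictly convex if it is strictly convex on every convex subset of $\{w:\partial\phi(w)\neq\emptyset\}$ ($\partial\phi$ the convex subdifferential); Legendre if both. Assumptions on $\phi$: (A1) $\phi$ is proper lsc convex and Legendre; (A2) $\operatorname{dom}\phi$ is open; (A3) $\phi$ is twice continuously differentiable on $\operatorname{int}\operatorname{dom}\phi$ with $\nabla^2\phi(w)\succ0$ for all $w\in\operatorname{int}\operatorname{dom}\phi$; (A4) $\phi$ is super-coercive: $|\phi(w)|/\|w\|\to\infty$ whenever $\|w\|\to\infty$; (A5) $\phi(0)=0$ and $\nabla\phi(0)=0$. For $\lambda>0$, the $\phi$-envelope and $\phi$-proximal mapping of $f$ are $$e_\lambda^\phi f(v)=\inf_{z\in\mathbb{R}^m}f(z)+\tfrac1\lambda\phi(v-z),\qquad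 P_\lambda^\phi f(v)=\operatorname*{arg\,min}_{z\in\mathbb{R}^m}f(z)+\tfrac1\lambda\phi(v-z).$$ $f$ is $\phi$-prox-bounded if there exists $\lambda>0$ such that for any $\bar v\in\mathbb{R}^m$ there exist $\epsilon>0$ and $\beta>-\infty$ with $e_\lambda^\phi f(v)\ge\beta$ for any $v$ with $\|v-\bar v\|\le\epsilon$. The supremum of the set of all such $\lambda$ is the threshold $\lambda_f$. Subdifferentials: for $\bar z\in\operatorname{dom}f$, $y\in\widehat\partial f(\bar z)$ (regular subdifferential) if $\liminf_{z\to\bar z,\,z\neq\bar z}\frac{f(z)-f(\bar z)-\langle y,z-\bar z\rangle}{\|z-\bar z\|}\ge0$; $y\in\partial f(\bar z)$ (limiting subdifferential) if there exist $z^\nu\to\bar z$ with $f(z^\nu)\to f(\bar z)$ and $y^\nu\in\widehat\partial f(z^\nu)$ with $y^\nu\to y$. Prox-regularity: $f$, lsc and finite at $\bar z$, is prox-regular at $\bar z$ for $\bar y\in\partial f(\bar z)$ if there exist $\epsilon>0$ and $r\ge0$ such that for all $\|z'-\bar z\|<\epsilon$, $f(z')\ge f(z)+\langle y,z'-z\rangle-\frac r2\|z'-z\|^2$ whenever $\|z-\bar z\|<\epsilon$, $f(z)-f(\bar z)<\epsilon$, $y\in\partial f(z)$, $\|y-\bar y\|<\epsilon$. *)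

theory Defs
  imports "HOL-Analysis.Analysis"
begin

section \<open>Extended-real-valued functions\<close>

definition edom :: "('a \<Rightarrow> ereal) \<Rightarrow> 'a set" where
  "edom f = {z. f z < \<infinity>}"

definition proper :: "('a \<Rightarrow> ereal) \<Rightarrow> bool" where
  "proper f \<longleftrightarrow> (\<forall>z. f z > -\<infinity>) \<and> (\<exists>z. f z < \<infinity>)"

definition lsc_at :: "('a::topological_space \<Rightarrow> ereal) \<Rightarrow> 'a \<Rightarrow> bool" where
  "lsc_at f x \<longleftrightarrow> f x \<le> Liminf (at x) f"

definition lsc :: "('a::topological_space \<Rightarrow> ereal) \<Rightarrow> bool" where
  "lsc f \<longleftrightarrow> (\<forall>x. lsc_at f x)"

text \<open>Restricting to \<open>0 < t < 1\<close> avoids the products \<open>0 * \<infinity>\<close>. The sums below are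
  unambiguous for functions that do not take the value \<open>-\<infinity>\<close>, the only ones to which the
  notions are applied.\<close>

definition econvex :: "('a::real_vector \<Rightarrow> ereal) \<Rightarrow> bool" where
  "econvex f \<longleftrightarrow> (\<forall>x y. \<forall>t\<in>{0<..<1}.
     f ((1 - t) *\<^sub>R x + t *\<^sub>R y) \<le> ereal (1 - t) * f x + ereal t * f y)"

definition strictly_econvex_on :: "'a::real_vector set \<Rightarrow> ('a \<Rightarrow> ereal) \<Rightarrow> bool" where
  "strictly_econvex_on C f \<longleftrightarrow> (\<forall>x\<in>C. \<forall>y\<in>C. x \<noteq> y \<longrightarrow> (\<forall>t\<in>{0<..<1}.
     f ((1 - t) *\<^sub>R x + t *\<^sub>R y) < ereal (1 - t) * f x + ereal t * f y))"

text \<open>Differentiability of an extended-real-valued function at a point includes finiteness of the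
  function on a neighbourhood of that point.\<close>

definition has_gradient :: "('a::real_inner \<Rightarrow> ereal) \<Rightarrow> 'a \<Rightarrow> 'a \<Rightarrow> bool" where
  "has_gradient f x D \<longleftrightarrow>
     (\<forall>\<^sub>F z in nhds x. \<bar>f z\<bar> \<noteq> \<infinity>) \<and> GDERIV (\<lambda>z. real_of_ereal (f z)) x :> D"

definition ediff_at :: "('a::real_inner \<Rightarrow> ereal) \<Rightarrow> 'a \<Rightarrow> bool" where
  "ediff_at f x \<longleftrightarrow> (\<exists>D. has_gradient f x D)"

definition gradient :: "('a::real_inner \<Rightarrow> ereal) \<Rightarrow> 'a \<Rightarrow> 'a" where
  "gradient f x = (THE D. has_gradient f x D)"

definition hessian :: "(real^'n \<Rightarrow> ereal) \<Rightarrow> real^'n \<Rightarrow> real^'n^'n" where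
  "hessian f x = jacobian (gradient f) (at x)"

lemma gradient_eq:
  assumes "has_gradient f x D"
  shows "gradient f x = D"
proof -
  have "D' = D" if "has_gradient f x D'" for D'
  proof -
    have "(\<lambda>h. inner h D') = (\<lambda>h. inner h D)"
      using assms that has_derivative_unique unfolding has_gradient_def gderiv_def by blast
    then show ?thesis
      by (metis inner_commute vector_eq_ldot)
  qed
  then show ?thesis
    unfolding gradient_def using assms by (metis the_equality)
qed

definition lipschitz_differentiable_around ::
  "('a::real_inner \<Rightarrow> ereal) \<Rightarrow> 'a \<Rightarrow> bool" where
  "lipschitz_differentiable_around f x \<longleftrightarrow> (\<exists>U. open U \<and> x \<in> U \<and>
     (\<forall>u\<in>U. ediff_at f u) \<and> (\<exists>L. L-lipschitz_on U (gradient f)))"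

definition conjugate :: "('a::real_inner \<Rightarrow> ereal) \<Rightarrow> 'a \<Rightarrow> ereal" where
  "conjugate f y = (SUP w. ereal (inner y w) - f w)"

section \<open>Legendre functions and the assumptions on the coupling\<close>

definition convex_subdiff :: "('a::real_inner \<Rightarrow> ereal) \<Rightarrow> 'a \<Rightarrow> 'a set" where
  "convex_subdiff f w =
     {y. \<bar>f w\<bar> \<noteq> \<infinity> \<and> (\<forall>z. f z \<ge> f w + ereal (inner y (z - w)))}"

definition essentially_smooth :: "('a::real_inner \<Rightarrow> ereal) \<Rightarrow> bool" where
  "essentially_smooth f \<longleftrightarrow>
     interior (edom f) \<noteq> {} \<and>
     (\<forall>w\<in>interior (edom f). ediff_at f w) \<and>
     (\<forall>W w. (\<forall>n. W n \<in> interior (edom f)) \<and> W \<longlonglongrightarrow> w \<and> w \<in> frontier (edom f) \<longrightarrow>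
        filterlim (\<lambda>n. norm (gradient f (W n))) at_top sequentially)"

definition essentially_strictly_convex :: "('a::real_inner \<Rightarrow> ereal) \<Rightarrow> bool" where
  "essentially_strictly_convex f \<longleftrightarrow>
     (\<forall>C. convex C \<and> C \<subseteq> {w. convex_subdiff f w \<noteq> {}} \<longrightarrow> strictly_econvex_on C f)"

definition legendre :: "('a::real_inner \<Rightarrow> ereal) \<Rightarrow> bool" where
  "legendre f \<longleftrightarrow> essentially_smooth f \<and> essentially_strictly_convex f"

text \<open>Symmetry of the Hessian is not demanded: it is automatic for a continuous one.\<close>

definition C2_pos_def_Hessian :: "(real^'n \<Rightarrow> ereal) \<Rightarrow> bool" where
  "C2_pos_def_Hessian f \<longleftrightarrow>
     (\<forall>w\<in>interior (edom f). ediff_at f w \<and> gradient f differentiable (at w)) \<and>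
     continuous_on (interior (edom f)) (hessian f) \<and>
     (\<forall>w\<in>interior (edom f). \<forall>h. h \<noteq> 0 \<longrightarrow> inner h (hessian f w *v h) > 0)"

definition super_coercive :: "('a::real_normed_vector \<Rightarrow> ereal) \<Rightarrow> bool" where
  "super_coercive f \<longleftrightarrow> ((\<lambda>w. \<bar>f w\<bar> / ereal (norm w)) \<longlongrightarrow> \<infinity>) at_infinity"

section \<open>Envelope and proximal mapping\<close>

definition envelope ::
  "('a::ab_group_add \<Rightarrow> ereal) \<Rightarrow> real \<Rightarrow> ('a \<Rightarrow> ereal) \<Rightarrow> 'a \<Rightarrow> ereal" where
  "envelope \<phi> lam f v = (INF z. f z + ereal (1 / lam) * \<phi> (v - z))"

definition prox ::
  "('a::ab_group_add \<Rightarrow> ereal) \<Rightarrow> real \<Rightarrow> ('a \<Rightarrow> ereal) \<Rightarrow> 'a \<Rightarrow> 'a set" where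
  "prox \<phi> lam f v =
     {z. is_arg_min (\<lambda>z. f z + ereal (1 / lam) * \<phi> (v - z)) (\<lambda>_. True) z}"

definition prox_bounded_with ::
  "('a::real_normed_vector \<Rightarrow> ereal) \<Rightarrow> ('a \<Rightarrow> ereal) \<Rightarrow> real \<Rightarrow> bool" where
  "prox_bounded_with \<phi> f lam \<longleftrightarrow> lam > 0 \<and>
     (\<forall>vbar. \<exists>\<epsilon>>0. \<exists>\<beta>::ereal. \<beta> > -\<infinity> \<and>
        (\<forall>v. norm (v - vbar) \<le> \<epsilon> \<longrightarrow> envelope \<phi> lam f v \<ge> \<beta>))"

definition prox_bounded ::
  "('a::real_normed_vector \<Rightarrow> ereal) \<Rightarrow> ('a \<Rightarrow> ereal) \<Rightarrow> bool" where
  "prox_bounded \<phi> f \<longleftrightarrow> (\<exists>lam. prox_bounded_with \<phi> f lam)"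

definition prox_threshold ::
  "('a::real_normed_vector \<Rightarrow> ereal) \<Rightarrow> ('a \<Rightarrow> ereal) \<Rightarrow> ereal" where
  "prox_threshold \<phi> f = (SUP lam\<in>{lam. prox_bounded_with \<phi> f lam}. ereal lam)"

section \<open>Subdifferentials and prox-regularity\<close>

definition regular_subdiff :: "('a::real_inner \<Rightarrow> ereal) \<Rightarrow> 'a \<Rightarrow> 'a set" where
  "regular_subdiff f x = {y. x \<in> edom f \<and>
     Liminf (at x) (\<lambda>z. (f z - f x - ereal (inner y (z - x))) / ereal (norm (z - x))) \<ge> 0}"

definition limiting_subdiff :: "('a::real_inner \<Rightarrow> ereal) \<Rightarrow> 'a \<Rightarrow> 'a set" where
  "limiting_subdiff f x = {y. x \<in> edom f \<and>
     (\<exists>Z Y. Z \<longlonglongrightarrow> x \<and> (\<lambda>n. f (Z n)) \<longlonglongrightarrow> f x \<and>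
        (\<forall>n. Y n \<in> regular_subdiff f (Z n)) \<and> Y \<longlonglongrightarrow> y)}"

definition prox_regular :: "('a::real_inner \<Rightarrow> ereal) \<Rightarrow> 'a \<Rightarrow> 'a \<Rightarrow> bool" where
  "prox_regular f zbar ybar \<longleftrightarrow>
     lsc_at f zbar \<and> \<bar>f zbar\<bar> \<noteq> \<infinity> \<and> ybar \<in> limiting_subdiff f zbar \<and>
     (\<exists>\<epsilon>>0. \<exists>r\<ge>0. \<forall>z'. norm (z' - zbar) < \<epsilon> \<longrightarrow>
        (\<forall>z y. norm (z - zbar) < \<epsilon> \<and> f z - f zbar < ereal \<epsilon> \<and>
               y \<in> limiting_subdiff f z \<and> norm (y - ybar) < \<epsilon> \<longrightarrow>
           f z' \<ge> f z + ereal (inner y (z' - z)) - ereal (r / 2 * (norm (z' - z))\<^sup>2)))"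

section \<open>Set-valued mappings\<close>

definition attentive_localization ::
  "('a::real_inner \<Rightarrow> ereal) \<Rightarrow> 'a \<Rightarrow> 'a \<Rightarrow> real \<Rightarrow> 'a \<Rightarrow> 'a set" where
  "attentive_localization f zbar ybar \<epsilon> z =
     (if norm (z - zbar) < \<epsilon> \<and> f z < f zbar + ereal \<epsilon>
      then {y \<in> limiting_subdiff f z. norm (y - ybar) < \<epsilon>} else {})"

definition set_valued_inverse :: "('a \<Rightarrow> 'b set) \<Rightarrow> 'b \<Rightarrow> 'a set" where
  "set_valued_inverse S v = {z. v \<in> S z}"

definition id_plus_grad_conj ::
  "('a::real_inner \<Rightarrow> ereal) \<Rightarrow> real \<Rightarrow> ('a \<Rightarrow> 'a set) \<Rightarrow> 'a \<Rightarrow> 'a set" where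
  "id_plus_grad_conj \<phi> lam T z = {z + gradient (conjugate \<phi>) (lam *\<^sub>R y) | y. y \<in> T z}"

definition single_valued_lipschitz_near ::
  "('a::metric_space \<Rightarrow> 'b::metric_space set) \<Rightarrow> 'a \<Rightarrow> bool" where
  "single_valued_lipschitz_near P vbar \<longleftrightarrow> (\<exists>U p L. open U \<and> vbar \<in> U \<and>
     (\<forall>v\<in>U. P v = {p v}) \<and> L-lipschitz_on U p)"

end

theory Submission
  imports Defs
begin

text \<open>
  The function minimized in the proximal problem is \<open>f + \<phi> (v - \<cdot>) / lam\<close>.  Near \<open>zbar\<close>, prox-regularity
  lets \<open>f\<close> fall below its linearizations by a quadratic with a fixed coefficient \<open>r\<close>, whereas the kernel
  \<open>\<phi>\<close>, having a positive definite continuous Hessian, is strongly convex near \<open>0\<close> with some modulus \<open>\<sigma>\<close>.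
  Dividing by \<open>lam\<close> amplifies this modulus, so for \<open>lam * r < \<sigma>\<close> the sum behaves like a strongly convex
  function.  For this the arguments \<open>v - z\<close> must stay near \<open>0\<close>.  They do, since \<open>ybar\<close> is fixed and
  \<open>gradient \<phi> (vbar - zbar) = lam *\<^sub>R ybar\<close> tends to \<open>0\<close> with \<open>lam\<close>; the linear growth of \<open>\<phi>\<close> away from
  its minimizer (\<open>kernel_growth\<close>) turns this into closeness of \<open>vbar\<close> and \<open>zbar\<close>.  Points far from \<open>zbar\<close>
  are excluded by comparison with one fixed parameter for which the envelope of \<open>f\<close> is locally bounded
  below (\<open>far_points_not_optimal\<close>).

  Minimizers then exist by compactness, lie within a multiple of \<open>norm (v - vbar)\<close> of \<open>zbar\<close>
  (\<open>prox_displacement\<close>), and satisfy Fermat's rule \<open>gradient \<phi> (v - z) / lam \<in> \<partial>f z\<close> with a subgradient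
  near \<open>ybar\<close> and a value of \<open>f\<close> near \<open>f zbar\<close> (\<open>prox_subgradient\<close>, \<open>prox_attentive\<close>).  Prox-regularity is
  therefore available at the minimizers.  Hypomonotonicity of the localized subdifferential against strong
  monotonicity of the gradient of \<open>\<phi>\<close> gives uniqueness and the Lipschitz estimate (\<open>prox_two_point\<close>).
  Conversely a localized solution of Fermat's rule is a minimizer (\<open>prox_if_localized\<close>).  The gradient of
  the conjugate inverts that of \<open>\<phi>\<close> near \<open>0\<close> (\<open>has_gradient_conjugate\<close>), and so Fermat's rule is the
  inverse formula (\<open>prox_eq_inverse\<close>).

  The envelope is differentiated by using the minimizer for one parameter value as a competitor for
  another (\<open>envelope_increment\<close>), which squeezes it between affine functions up to a quadratic error.
\<close>

section \<open>Gradients of extended-real-valued functions\<close>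

lemma has_gradient_finite: "has_gradient f x D \<Longrightarrow> \<bar>f x\<bar> \<noteq> \<infinity>"
  unfolding has_gradient_def by (auto dest: eventually_nhds_x_imp_x)

lemma has_gradient_gradient: "ediff_at f x \<Longrightarrow> has_gradient f x (gradient f x)"
  unfolding ediff_at_def using gradient_eq by metis

lemma has_gradient_line_derivative:
  assumes "has_gradient f (x + t *\<^sub>R d) D"
  shows "((\<lambda>s. real_of_ereal (f (x + s *\<^sub>R d))) has_real_derivative inner D d) (at t)"
proof -
  have 1: "((\<lambda>z. real_of_ereal (f z)) has_derivative (\<lambda>h. inner h D)) (at (x + t *\<^sub>R d))"
    using assms unfolding has_gradient_def gderiv_def by blast
  have "((\<lambda>s. x + s *\<^sub>R d) has_derivative (\<lambda>s. s *\<^sub>R d)) (at t)"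
    by (auto intro!: derivative_eq_intros)
  from has_derivative_compose[OF this 1]
  show ?thesis
    unfolding has_field_derivative_def by (simp add: inner_commute mult_commute_abs)
qed

text \<open>Both the conjugate of the kernel and the envelope are differentiated by
  sandwiching them between two affine functions that differ by a quadratic error; this is the common
  last step.\<close>

lemma has_gradientI_quadratic:
  fixes f :: "'a::real_inner \<Rightarrow> ereal"
  assumes fin: "\<forall>\<^sub>F z in nhds x. \<bar>f z\<bar> \<noteq> \<infinity>"
    and bnd: "\<forall>\<^sub>F z in nhds x.
      \<bar>real_of_ereal (f z) - real_of_ereal (f x) - inner D (z - x)\<bar> \<le> C * (norm (z - x))\<^sup>2"
  shows "has_gradient f x D"
proof -
  have "((\<lambda>z. real_of_ereal (f z)) has_derivative (\<lambda>h. inner h D)) (at x)"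
  proof (rule has_derivativeI)
    show "bounded_linear (\<lambda>h. inner h D)" by (rule bounded_linear_inner_left)
    have lim: "((\<lambda>z. C * norm (z - x)) \<longlongrightarrow> 0) (at x)"
      by (auto intro!: tendsto_eq_intros)
    have "\<forall>\<^sub>F z in at x.
      norm ((real_of_ereal (f z) - real_of_ereal (f x) - inner (z - x) D) /\<^sub>R norm (z - x))
        \<le> C * norm (z - x)"
      unfolding eventually_at_filter
    proof (rule eventually_mono[OF bnd], intro impI)
      fix z assume z: "z \<noteq> x"
        and le: "\<bar>real_of_ereal (f z) - real_of_ereal (f x) - inner D (z - x)\<bar> \<le> C * (norm (z - x))\<^sup>2"
      have "\<bar>real_of_ereal (f z) - real_of_ereal (f x) - inner D (z - x)\<bar> / norm (z - x)
          \<le> C * norm (z - x)"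
        using le z by (simp add: pos_divide_le_eq power2_eq_square mult.assoc)
      then show "norm ((real_of_ereal (f z) - real_of_ereal (f x) - inner (z - x) D) /\<^sub>R norm (z - x))
        \<le> C * norm (z - x)"
        by (simp add: inner_commute[of D] divide_inverse mult.commute abs_mult)
    qed
    from Lim_null_comparison[OF this lim]
    show "((\<lambda>z. (real_of_ereal (f z) - real_of_ereal (f x) - inner (z - x) D) /\<^sub>R norm (z - x))
      \<longlongrightarrow> 0) (at x)" .
  qed
  then show ?thesis
    using fin unfolding has_gradient_def gderiv_def by blast
qed

text \<open>The difference quotients of \<open>f\<close> along the segment from \<open>x\<close> to \<open>y\<close> are at most
  \<open>f y - f x\<close>, and they tend to \<open>inner D (y - x)\<close>.  The point \<open>y\<close> may lie outside the domain or on
  its boundary, which is what makes the inequality global.\<close>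

lemma econvex_gradient_inequality:
  fixes f :: "'a::real_inner \<Rightarrow> ereal"
  assumes cvx: "econvex f" and nm: "\<And>z. f z > -\<infinity>" and grad: "has_gradient f x D"
  shows "f x + ereal (inner D (y - x)) \<le> f y"
proof (cases "f y = \<infinity>")
  case False
  then obtain b where b: "f y = ereal b"
    using nm[of y] by (cases "f y") auto
  obtain a where a: "f x = ereal a"
    using has_gradient_finite[OF grad] by (cases "f x") auto
  let ?q = "\<lambda>t. real_of_ereal (f (x + t *\<^sub>R (y - x)))"
  have q0: "?q 0 = a" using a by simp
  have "(?q has_real_derivative inner D (y - x)) (at 0)"
    by (rule has_gradient_line_derivative) (use grad in simp)
  then have "((\<lambda>t. (?q t - ?q 0) / t) \<longlongrightarrow> inner D (y - x)) (at_right 0)"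
    unfolding has_field_derivative_iff
    by (simp add: filterlim_at_split)
  moreover have "\<forall>\<^sub>F t in at_right 0. (?q t - ?q 0) / t \<le> b - a"
    unfolding eventually_at_right_field
  proof (intro exI[of _ "1 :: real"] conjI allI impI)
    show "0 < (1 :: real)" by simp
    fix t :: real assume "0 < t" "t < 1"
    then have t: "0 < t \<and> t < 1" by blast
    then have "f ((1 - t) *\<^sub>R x + t *\<^sub>R y) \<le> ereal (1 - t) * f x + ereal t * f y"
      using cvx unfolding econvex_def by auto
    moreover have "(1 - t) *\<^sub>R x + t *\<^sub>R y = x + t *\<^sub>R (y - x)"
      by (simp add: algebra_simps)
    ultimately have le: "f (x + t *\<^sub>R (y - x)) \<le> ereal ((1 - t) * a + t * b)"
      by (simp add: a b)
    then have "?q t \<le> (1 - t) * a + t * b"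
      using nm[of "x + t *\<^sub>R (y - x)"] by (cases "f (x + t *\<^sub>R (y - x))") auto
    then show "(?q t - ?q 0) / t \<le> b - a"
      using t unfolding q0 by (simp add: divide_simps algebra_simps)
  qed
  ultimately have "inner D (y - x) \<le> b - a"
    by (rule tendsto_upperbound) simp
  then show ?thesis by (simp add: a b)
qed simp

section \<open>Kernels with strongly monotone gradient near the origin\<close>

text \<open>The kernel is extended-real-valued on the whole space, but all estimates take place in a ball
  around its minimizer \<open>0\<close>, on which it is finite and behaves like a strongly convex quadratic.
  Convexity carries the estimates from the ball to the rest of the space.\<close>

locale local_kernel =
  fixes \<phi> :: "'a::euclidean_space \<Rightarrow> ereal" and \<rho> \<sigma> L :: real
  assumes pos: "0 < \<rho>" "0 < \<sigma>" "0 \<le> L"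
    and proper_kernel: "proper \<phi>" and convex_kernel: "econvex \<phi>"
    and kernel_0: "\<phi> 0 = 0" and gradient_0: "has_gradient \<phi> 0 0"
    and has_gradient: "norm w < \<rho> \<Longrightarrow> has_gradient \<phi> w (gradient \<phi> w)"
    and strongly_monotone: "norm w < \<rho> \<Longrightarrow> norm w' < \<rho> \<Longrightarrow>
      \<sigma> * (norm (w - w'))\<^sup>2 \<le> inner (gradient \<phi> w - gradient \<phi> w') (w - w')"
    and gradient_lipschitz: "norm w < \<rho> \<Longrightarrow> norm w' < \<rho> \<Longrightarrow>
      norm (gradient \<phi> w - gradient \<phi> w') \<le> L * norm (w - w')"
begin

abbreviation \<Phi> :: "'a \<Rightarrow> real" where
  "\<Phi> w \<equiv> real_of_ereal (\<phi> w)"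

lemma kernel_real: "norm w < \<rho> \<Longrightarrow> \<phi> w = ereal (\<Phi> w)"
  using has_gradient_finite[OF has_gradient] by (metis ereal_real')

lemma gradient_at_0 [simp]: "gradient \<phi> 0 = 0"
  by (rule gradient_eq[OF gradient_0])

lemma gradient_inequality:
  "has_gradient \<phi> w D \<Longrightarrow> \<phi> w + ereal (inner D (w' - w)) \<le> \<phi> w'"
  by (rule econvex_gradient_inequality[OF convex_kernel])
    (use proper_kernel in \<open>auto simp: proper_def\<close>)

lemma kernel_nonneg: "0 \<le> \<phi> w"
  using gradient_inequality[OF gradient_0, of w] by (simp add: kernel_0)

lemma gradient_inequality_real:
  assumes "norm w < \<rho>" "norm w' < \<rho>"
  shows "\<Phi> w + inner (gradient \<phi> w) (w' - w) \<le> \<Phi> w'"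
  using gradient_inequality[OF has_gradient[OF assms(1)], of w'] kernel_real assms
  by (metis ereal_less_eq(3) plus_ereal.simps(1))

lemma strongly_convex:
  assumes w: "norm w < \<rho>" and w': "norm w' < \<rho>"
  shows "\<Phi> w + inner (gradient \<phi> w) (w' - w) + \<sigma> / 2 * (norm (w' - w))\<^sup>2 \<le> \<Phi> w'"
proof -
  let ?d = "w' - w"
  let ?q = "\<lambda>t. \<Phi> (w + t *\<^sub>R ?d) - t * inner (gradient \<phi> w) ?d - \<sigma> / 2 * t\<^sup>2 * (norm ?d)\<^sup>2"
  have "?q 0 \<le> ?q 1"
  proof (rule DERIV_nonneg_imp_nondecreasing[where f = ?q])
    fix t :: real assume t: "0 \<le> t" "t \<le> 1"
    let ?x = "w + t *\<^sub>R ?d"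
    have "?x = (1 - t) *\<^sub>R w + t *\<^sub>R w'" by (simp add: algebra_simps)
    then have "?x \<in> ball 0 \<rho>"
      using t w w' convexD[OF convex_ball[of 0 \<rho>], of w w' "1 - t" t] by simp
    then have x: "norm ?x < \<rho>" by simp
    have "(?q has_real_derivative
        (inner (gradient \<phi> ?x) ?d - inner (gradient \<phi> w) ?d - \<sigma> * t * (norm ?d)\<^sup>2)) (at t)"
    proof (intro DERIV_diff has_gradient_line_derivative has_gradient x)
      show "((\<lambda>t. t * inner (gradient \<phi> w) ?d) has_real_derivative inner (gradient \<phi> w) ?d) (at t)"
        by (auto intro!: derivative_eq_intros)
      show "((\<lambda>t. \<sigma> / 2 * t\<^sup>2 * (norm ?d)\<^sup>2) has_real_derivative \<sigma> * t * (norm ?d)\<^sup>2) (at t)"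
        by (auto intro!: derivative_eq_intros)
    qed
    moreover have "0 \<le> inner (gradient \<phi> ?x) ?d - inner (gradient \<phi> w) ?d - \<sigma> * t * (norm ?d)\<^sup>2"
    proof (cases "t = 0")
      case False
      have "\<sigma> * (norm (t *\<^sub>R ?d))\<^sup>2 \<le> inner (gradient \<phi> ?x - gradient \<phi> w) (t *\<^sub>R ?d)"
        using strongly_monotone[OF x w] by simp
      then have "t * (\<sigma> * t * (norm ?d)\<^sup>2) \<le> t * (inner (gradient \<phi> ?x) ?d - inner (gradient \<phi> w) ?d)"
        by (simp add: power2_eq_square inner_diff_left mult_ac)
      then show ?thesis using t False by simp
    qed simp
    ultimately show "\<exists>y. (?q has_real_derivative y) (at t) \<and> 0 \<le> y" by blast
  qed simp
  then show ?thesis by simp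
qed

lemma kernel_continuous: "norm w < \<rho> \<Longrightarrow> isCont \<Phi> w"
  using has_gradient[of w] unfolding has_gradient_def gderiv_def
  by (blast intro: has_derivative_continuous)

text \<open>Project \<open>w\<close> radially to a point \<open>u\<close> of the sphere of radius \<open>s\<close>.  Strong convexity gives
  \<open>\<Phi> u \<ge> \<sigma> s\<^sup>2 / 2\<close> and slope at least \<open>\<sigma> s\<close> in the radial direction, and by convexity the
  function stays above its tangent at \<open>u\<close>.\<close>

lemma kernel_growth:
  assumes s: "0 < s" "s < \<rho>" and w: "s \<le> norm w"
  shows "ereal (\<sigma> * s / 2 * norm w) \<le> \<phi> w"
proof -
  have nw: "0 < norm w" using s w by linarith
  define u where "u = (s / norm w) *\<^sub>R w"
  have nu: "norm u = s" using nw s by (simp add: u_def)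
  have uw: "w - u = (norm w / s - 1) *\<^sub>R u"
    using nw s by (simp add: u_def algebra_simps)
  have "\<sigma> * s\<^sup>2 \<le> inner (gradient \<phi> u) u"
    using strongly_monotone[of u 0] nu s by simp
  moreover have "0 \<le> norm w / s - 1" using w s by simp
  ultimately have "(norm w / s - 1) * (\<sigma> * s\<^sup>2) \<le> inner (gradient \<phi> u) (w - u)"
    unfolding uw inner_scaleR_right by (rule mult_left_mono)
  moreover have "\<sigma> / 2 * s\<^sup>2 \<le> \<Phi> u"
    using strongly_convex[of 0 u] nu s by (simp add: kernel_0)
  moreover have "(norm w / s - 1) * (\<sigma> * s\<^sup>2) = \<sigma> * s * norm w - \<sigma> * s\<^sup>2"
    using s by (simp add: field_simps power2_eq_square)
  moreover have "\<sigma> * s\<^sup>2 \<le> \<sigma> * s * norm w"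
    using mult_left_mono[OF w, of "\<sigma> * s"] pos s by (simp add: power2_eq_square mult_ac)
  ultimately have "\<sigma> * s / 2 * norm w \<le> \<Phi> u + inner (gradient \<phi> u) (w - u)"
    by (simp add: field_simps)
  also have "ereal \<dots> = \<phi> u + ereal (inner (gradient \<phi> u) (w - u))"
    using kernel_real[of u] nu s by (metis plus_ereal.simps(1))
  also have "\<dots> \<le> \<phi> w"
    by (rule gradient_inequality[OF has_gradient]) (use nu s in simp)
  finally show ?thesis by simp
qed

text \<open>Convexity against the value \<open>0\<close> at the origin gives \<open>\<phi> w \<le> \<langle>D, w\<rangle>\<close>, which contradicts the
  linear growth if \<open>w\<close> is not close to the origin.  Here \<open>w\<close> is any point of differentiability, a
  priori outside the ball.\<close>

lemma norm_less_if_gradient_small: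
  assumes D: "has_gradient \<phi> w D" and s: "0 < s" "s < \<rho>" and small: "norm D < \<sigma> * s / 2"
  shows "norm w < s"
proof (rule ccontr)
  assume "\<not> norm w < s"
  then have sw: "s \<le> norm w" by simp
  have "\<phi> w + ereal (inner D (0 - w)) \<le> 0"
    using gradient_inequality[OF D, of 0] by (simp add: kernel_0)
  moreover have "ereal (\<sigma> * s / 2 * norm w) \<le> \<phi> w"
    by (rule kernel_growth[OF s sw])
  ultimately have "\<sigma> * s / 2 * norm w \<le> inner D w"
    using has_gradient_finite[OF D] by (cases "\<phi> w") auto
  also have "\<dots> \<le> norm D * norm w" by (rule norm_cauchy_schwarz)
  finally have "\<sigma> * s / 2 * norm w \<le> norm D * norm w" .
  moreover have "0 < norm w" using sw s by linarith
  ultimately have "\<sigma> * s / 2 \<le> norm D" by (rule mult_right_le_imp_le)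
  then show False using small by simp
qed

text \<open>A minimizer of \<open>\<Phi> - \<langle>u, \<cdot>\<rangle>\<close> over the closed ball of radius \<open>s\<close> has value at most
  \<open>0\<close>, while on the sphere the growth of \<open>\<Phi>\<close> beats \<open>\<langle>u, \<cdot>\<rangle>\<close>.  Hence it is an interior
  critical point.\<close>

lemma gradient_attains_small:
  assumes s: "0 < s" "s < \<rho>" and u: "norm u < \<sigma> * s / 2"
  obtains w where "norm w < s" "gradient \<phi> w = u"
proof -
  let ?g = "\<lambda>w. \<Phi> w - inner u w"
  have cont: "continuous_on (cball 0 s) ?g"
    by (intro continuous_intros continuous_at_imp_continuous_on ballI kernel_continuous)
      (use s in auto)
  obtain w where w: "w \<in> cball 0 s" "\<And>x. x \<in> cball 0 s \<Longrightarrow> ?g w \<le> ?g x"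
    using continuous_attains_inf[OF compact_cball _ cont] s by auto
  have le0: "\<Phi> w \<le> inner u w"
    using w(2)[of 0] s by (simp add: kernel_0)
  have ws: "norm w < s"
  proof (rule ccontr)
    assume "\<not> norm w < s"
    then have nw: "norm w = s" using w(1) by simp
    then have "ereal (\<sigma> * s / 2 * norm w) \<le> \<phi> w"
      using kernel_growth[OF s, of w] by simp
    then have "\<sigma> * s / 2 * norm w \<le> \<Phi> w"
      using kernel_real[of w] nw s by (metis ereal_less_eq(3))
    also have "\<dots> \<le> norm u * norm w" using le0 norm_cauchy_schwarz[of u w] by linarith
    finally show False using u nw s by simp
  qed
  have "(\<Phi> has_derivative (\<lambda>h. inner h (gradient \<phi> w))) (at w)"
    using has_gradient[of w] ws s unfolding has_gradient_def gderiv_def by simp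
  then have "(?g has_derivative (\<lambda>h. inner h (gradient \<phi> w) - inner u h)) (at w)"
    by (rule has_derivative_diff) (auto intro!: derivative_eq_intros)
  then have "(\<lambda>h. inner h (gradient \<phi> w) - inner u h) = (\<lambda>h. 0)"
    by (rule differential_zero_maxmin[of w "ball 0 s", rotated 2]) (use w ws in auto)
  then have "inner h (gradient \<phi> w - u) = 0" for h
    by (metis inner_commute inner_diff_right)
  then have "gradient \<phi> w = u"
    by (metis inner_eq_zero_iff right_minus_eq)
  with ws show ?thesis by (rule that)
qed

lemma norm_le_gradient:
  assumes w: "norm w < \<rho>" and w': "norm w' < \<rho>"
  shows "\<sigma> * norm (w - w') \<le> norm (gradient \<phi> w - gradient \<phi> w')"
proof (cases "w = w'")
  case False
  have "\<sigma> * (norm (w - w'))\<^sup>2 \<le> norm (gradient \<phi> w - gradient \<phi> w') * norm (w - w')"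
    using strongly_monotone[OF w w'] norm_cauchy_schwarz order_trans by blast
  then show ?thesis using False by (simp add: power2_eq_square)
qed simp

lemma conjugate_at_gradient:
  assumes w: "norm w < \<rho>"
  shows "conjugate \<phi> (gradient \<phi> w) = ereal (inner (gradient \<phi> w) w - \<Phi> w)"
  unfolding conjugate_def
proof (rule antisym)
  show "(SUP x. ereal (inner (gradient \<phi> w) x) - \<phi> x) \<le> ereal (inner (gradient \<phi> w) w - \<Phi> w)"
  proof (rule SUP_least)
    fix x
    show "ereal (inner (gradient \<phi> w) x) - \<phi> x \<le> ereal (inner (gradient \<phi> w) w - \<Phi> w)"
      using gradient_inequality[OF has_gradient[OF w], of x] kernel_real[OF w] kernel_nonneg[of x]
      by (cases "\<phi> x"; cases "\<phi> w") (auto simp: inner_diff_right)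
  qed
  have "ereal (inner (gradient \<phi> w) w - \<Phi> w) = ereal (inner (gradient \<phi> w) w) - \<phi> w"
    by (subst (2) kernel_real[OF w]) simp
  also have "\<dots> \<le> (SUP x. ereal (inner (gradient \<phi> w) x) - \<phi> x)"
    by (rule SUP_upper) simp
  finally show "ereal (inner (gradient \<phi> w) w - \<Phi> w) \<le> (SUP x. ereal (inner (gradient \<phi> w) x) - \<phi> x)" .
qed

text \<open>For \<open>u\<close> near \<open>gradient \<phi> w\<close> write \<open>u = gradient \<phi> x\<close>.  The supremum defining the conjugate is
  attained at \<open>x\<close> for \<open>u\<close> and at \<open>w\<close> for \<open>gradient \<phi> w\<close>.  Testing each supremum with the other
  maximizer bounds the remainder of the affine approximation with slope \<open>w\<close> by
  \<open>\<langle>u - gradient \<phi> w, x - w\<rangle>\<close>, which is quadratic because the local inverse of the gradient is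
  \<open>1 / \<sigma>\<close>-Lipschitz.\<close>

lemma has_gradient_conjugate:
  assumes s: "0 < s" "s < \<rho>" and w: "norm w < \<rho>" and small: "norm (gradient \<phi> w) < \<sigma> * s / 2"
  shows "has_gradient (conjugate \<phi>) (gradient \<phi> w) w"
proof -
  let ?u = "gradient \<phi> w"
  have near: "\<forall>\<^sub>F u in nhds ?u. norm u < \<sigma> * s / 2"
    using small by (intro order_tendstoD(2)[OF tendsto_norm[OF filterlim_ident]]) 
  have *: "\<bar>conjugate \<phi> u\<bar> \<noteq> \<infinity> \<and> \<bar>real_of_ereal (conjugate \<phi> u) - real_of_ereal (conjugate \<phi> ?u)
      - inner w (u - ?u)\<bar> \<le> (1 / \<sigma>) * (norm (u - ?u))\<^sup>2" if u: "norm u < \<sigma> * s / 2" for u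
  proof -
    obtain x where x: "norm x < s" "gradient \<phi> x = u"
      using gradient_attains_small[OF s u] by blast
    have xr: "norm x < \<rho>" using x s by simp
    note cu = conjugate_at_gradient[OF xr, unfolded x]
    note cw = conjugate_at_gradient[OF w]
    have lo: "\<Phi> x + inner u (w - x) \<le> \<Phi> w"
      using gradient_inequality_real[OF xr w] x by simp
    have hi: "\<Phi> w + inner ?u (x - w) \<le> \<Phi> x"
      using gradient_inequality_real[OF w xr] .
    have "inner (u - ?u) (x - w) \<le> norm (u - ?u) * norm (x - w)"
      by (rule norm_cauchy_schwarz)
    also have "\<dots> \<le> norm (u - ?u) * (norm (u - ?u) / \<sigma>)"
      using norm_le_gradient[OF xr w] pos x
      by (intro mult_left_mono) (auto simp: field_simps)
    finally have "inner (u - ?u) (x - w) \<le> (1 / \<sigma>) * (norm (u - ?u))\<^sup>2"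
      by (simp add: power2_eq_square)
    then show ?thesis
      using lo hi unfolding cu cw by (simp add: inner_diff inner_commute abs_le_iff)
  qed
  show ?thesis
  proof (rule has_gradientI_quadratic[where C = "1 / \<sigma>"])
    show "\<forall>\<^sub>F u in nhds ?u. \<bar>conjugate \<phi> u\<bar> \<noteq> \<infinity>"
      using near by (rule eventually_mono) (rule *[THEN conjunct1])
    show "\<forall>\<^sub>F u in nhds ?u. \<bar>real_of_ereal (conjugate \<phi> u) - real_of_ereal (conjugate \<phi> ?u)
        - inner w (u - ?u)\<bar> \<le> 1 / \<sigma> * (norm (u - ?u))\<^sup>2"
      using near by (rule eventually_mono) (rule *[THEN conjunct2])
  qed
qed

end

section \<open>Kernels with positive definite Hessian\<close>

text \<open>The quadratic form and the norm of the image attain their extrema over the compact set of pairs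
  of a base point and a unit vector; homogeneity does the rest.\<close>

lemma pos_def_matrix_bounds:
  fixes H :: "real^'n \<Rightarrow> real^'n^'n"
  assumes S: "compact S" and cont: "continuous_on S H"
    and pd: "\<And>w h. w \<in> S \<Longrightarrow> h \<noteq> 0 \<Longrightarrow> inner h (H w *v h) > 0"
  obtains \<sigma> L where "0 < \<sigma>" "0 \<le> L"
    "\<And>w h. w \<in> S \<Longrightarrow> \<sigma> * (norm h)\<^sup>2 \<le> inner h (H w *v h)"
    "\<And>w h. w \<in> S \<Longrightarrow> norm (H w *v h) \<le> L * norm h"
proof (cases "S = {}")
  case True
  then show ?thesis using that[of 1 0] by simp
next
  case False
  let ?K = "S \<times> sphere (0 :: real^'n) 1"
  have K: "compact ?K" "?K \<noteq> {}"
    using False S by (auto intro: compact_Times)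
  have c1: "continuous_on ?K (\<lambda>p. H (fst p) *v snd p)"
    unfolding matrix_vector_mult_def
    by (intro continuous_intros continuous_on_compose2[OF cont]) auto
  then have c2: "continuous_on ?K (\<lambda>p. inner (snd p) (H (fst p) *v snd p))"
    and c3: "continuous_on ?K (\<lambda>p. norm (H (fst p) *v snd p))"
    by (auto intro!: continuous_intros)
  obtain a where a: "a \<in> ?K"
    "\<And>p. p \<in> ?K \<Longrightarrow> inner (snd a) (H (fst a) *v snd a) \<le> inner (snd p) (H (fst p) *v snd p)"
    using continuous_attains_inf[OF K c2] by blast
  obtain b where b: "b \<in> ?K"
    "\<And>p. p \<in> ?K \<Longrightarrow> norm (H (fst p) *v snd p) \<le> norm (H (fst b) *v snd b)"
    using continuous_attains_sup[OF K c3] by blast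
  let ?\<sigma> = "inner (snd a) (H (fst a) *v snd a)" and ?L = "norm (H (fst b) *v snd b)"
  have unit: "(w, h /\<^sub>R norm h) \<in> ?K" if "w \<in> S" "h \<noteq> 0" for w h
    using that by simp
  show ?thesis
  proof (rule that)
    have "snd a \<noteq> 0" using a(1) by auto
    then show "0 < ?\<sigma>" using a(1) pd by auto
    show "0 \<le> ?L" by simp
    fix w h assume w: "w \<in> S"
    show "?\<sigma> * (norm h)\<^sup>2 \<le> inner h (H w *v h)"
    proof (cases "h = 0")
      case False
      have "?\<sigma> \<le> inner (h /\<^sub>R norm h) (H w *v (h /\<^sub>R norm h))"
        using a(2)[OF unit[OF w False]] by simp
      also have "\<dots> = inner h (H w *v h) / (norm h)\<^sup>2"
        by (simp add: matrix_vector_mult_scaleR divide_inverse power2_eq_square mult_ac)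
      finally show ?thesis using False by (simp add: pos_le_divide_eq)
    qed simp
    show "norm (H w *v h) \<le> ?L * norm h"
    proof (cases "h = 0")
      case False
      have "norm (H w *v (h /\<^sub>R norm h)) \<le> ?L"
        using b(2)[OF unit[OF w False]] by simp
      then show ?thesis using False
        by (simp add: matrix_vector_mult_scaleR divide_inverse[symmetric] pos_divide_le_eq
            mult.commute flip: divide_inverse_commute)
    qed simp
  qed
qed

lemma strongly_monotone_if_pos_def_derivative:
  fixes G :: "'a::real_inner \<Rightarrow> 'a"
  assumes S: "convex S" "x \<in> S" "y \<in> S"
    and G: "\<And>w. w \<in> S \<Longrightarrow> (G has_derivative G' w) (at w)"
    and pd: "\<And>w h. w \<in> S \<Longrightarrow> \<sigma> * (norm h)\<^sup>2 \<le> inner h (G' w h)"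
  shows "\<sigma> * (norm (x - y))\<^sup>2 \<le> inner (G x - G y) (x - y)"
proof -
  let ?d = "x - y"
  let ?q = "\<lambda>t. inner ?d (G (y + t *\<^sub>R ?d)) - t * (\<sigma> * (norm ?d)\<^sup>2)"
  have "?q 0 \<le> ?q 1"
  proof (rule DERIV_nonneg_imp_nondecreasing[where f = ?q])
    fix t :: real assume t: "0 \<le> t" "t \<le> 1"
    let ?x = "y + t *\<^sub>R ?d"
    have "?x = (1 - t) *\<^sub>R y + t *\<^sub>R x" by (simp add: algebra_simps)
    then have x: "?x \<in> S"
      using t convexD[OF S(1,3,2), of "1 - t" t] by simp
    have "((\<lambda>t. y + t *\<^sub>R ?d) has_derivative (\<lambda>s. s *\<^sub>R ?d)) (at t)"
      by (auto intro!: derivative_eq_intros)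
    from has_derivative_compose[OF this G[OF x]]
    have "((\<lambda>t. inner ?d (G (y + t *\<^sub>R ?d))) has_derivative (\<lambda>s. inner ?d (G' ?x (s *\<^sub>R ?d)))) (at t)"
      by (rule has_derivative_inner_right)
    moreover have "G' ?x (s *\<^sub>R ?d) = s *\<^sub>R G' ?x ?d" for s
      using has_derivative_linear[OF G[OF x]] by (rule linear_scale)
    ultimately have "((\<lambda>t. inner ?d (G (y + t *\<^sub>R ?d))) has_real_derivative inner ?d (G' ?x ?d)) (at t)"
      unfolding has_field_derivative_def by (simp add: mult_commute_abs)
    moreover have "((\<lambda>t. t * (\<sigma> * (norm ?d)\<^sup>2)) has_real_derivative \<sigma> * (norm ?d)\<^sup>2) (at t)"
      by (auto intro!: derivative_eq_intros)
    ultimately have "(?q has_real_derivative inner ?d (G' ?x ?d) - \<sigma> * (norm ?d)\<^sup>2) (at t)"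
      by (rule DERIV_diff)
    then show "\<exists>y. (?q has_real_derivative y) (at t) \<and> 0 \<le> y"
      using pd[OF x, of ?d] by auto
  qed simp
  then show ?thesis by (simp add: inner_diff_left inner_diff_right inner_commute)
qed

lemma local_kernel_exists:
  fixes \<phi> :: "real^'n \<Rightarrow> ereal"
  assumes "proper \<phi>" "econvex \<phi>" "C2_pos_def_Hessian \<phi>" "\<phi> 0 = 0" "has_gradient \<phi> 0 0"
  obtains \<rho> \<sigma> L where "local_kernel \<phi> \<rho> \<sigma> L"
proof -
  note C2 = assms(3)[unfolded C2_pos_def_Hessian_def]
  have "\<forall>\<^sub>F z in nhds 0. z \<in> edom \<phi>"
    using assms(5) unfolding has_gradient_def
    by (auto elim!: eventually_mono simp: edom_def less_top[symmetric])
  then have "0 \<in> interior (edom \<phi>)"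
    unfolding eventually_nhds by (auto intro: interiorI)
  then obtain \<rho> where \<rho>: "0 < \<rho>" "cball 0 \<rho> \<subseteq> interior (edom \<phi>)"
    using open_contains_cball open_interior by blast
  have G: "(gradient \<phi> has_derivative (\<lambda>h. hessian \<phi> w *v h)) (at w)"
    and D: "ediff_at \<phi> w" if "w \<in> cball 0 \<rho>" for w
    using C2 \<rho>(2) that jacobian_works[of "gradient \<phi>"] unfolding hessian_def by blast+
  obtain \<sigma> L where *: "0 < \<sigma>" "0 \<le> L"
    "\<And>w h. w \<in> cball 0 \<rho> \<Longrightarrow> \<sigma> * (norm h)\<^sup>2 \<le> inner h (hessian \<phi> w *v h)"
    "\<And>w h. w \<in> cball 0 \<rho> \<Longrightarrow> norm (hessian \<phi> w *v h) \<le> L * norm h"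
    by (rule pos_def_matrix_bounds[OF compact_cball, of 0 \<rho> "hessian \<phi>"])
      (use C2 \<rho>(2) continuous_on_subset in blast)+
  have "local_kernel \<phi> \<rho> \<sigma> L"
  proof
    fix w w' :: "real^'n"
    assume w: "norm w < \<rho>"
    then have wb: "w \<in> cball 0 \<rho>" by simp
    show "has_gradient \<phi> w (gradient \<phi> w)" by (rule has_gradient_gradient[OF D[OF wb]])
    assume w': "norm w' < \<rho>"
    then have wb': "w' \<in> cball 0 \<rho>" by simp
    show "\<sigma> * (norm (w - w'))\<^sup>2 \<le> inner (gradient \<phi> w - gradient \<phi> w') (w - w')"
      by (rule strongly_monotone_if_pos_def_derivative[OF convex_cball wb wb' G *(3)])
    show "norm (gradient \<phi> w - gradient \<phi> w') \<le> L * norm (w - w')"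
    proof (rule differentiable_bound[OF convex_cball _ _ wb wb'])
      fix x :: "real^'n" assume x: "x \<in> cball 0 \<rho>"
      show "(gradient \<phi> has_derivative (\<lambda>h. hessian \<phi> x *v h)) (at x within cball 0 \<rho>)"
        by (rule has_derivative_at_withinI[OF G[OF x]])
      show "onorm (\<lambda>h. hessian \<phi> x *v h) \<le> L"
        by (rule onorm_le) (rule *(4)[OF x])
    qed
  qed (use assms \<rho> * in auto)
  then show ?thesis by (rule that)
qed


section \<open>Minimizers of lower semicontinuous functions and regular subgradients\<close>

lemma lsc_plus_continuous_eventually_greater:
  fixes f :: "'a::t2_space \<Rightarrow> ereal" and h :: "'a \<Rightarrow> real"
  assumes lsc: "lsc_at f z" and h: "isCont h z" and c: "c < f z + ereal (h z)"
  shows "\<forall>\<^sub>F u in nhds z. c < f u + ereal (h u)"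
proof -
  obtain d where d: "c < ereal d" "ereal d < f z + ereal (h z)"
    using ereal_dense2[OF c] by blast
  obtain d' where d': "c < ereal d'" "ereal d' < ereal d"
    using ereal_dense2[OF d(1)] by blast
  have fz: "ereal (d - h z) < f z"
    using d(2) by (cases "f z") auto
  then have "ereal (d - h z) < Liminf (at z) f"
    using lsc unfolding lsc_at_def by (rule less_le_trans)
  then have "\<forall>\<^sub>F u in at z. ereal (d - h z) < f u" by (rule less_LiminfD)
  then have "\<forall>\<^sub>F u in nhds z. u \<noteq> z \<longrightarrow> ereal (d - h z) < f u"
    by (simp add: eventually_at_filter)
  then have "\<forall>\<^sub>F u in nhds z. ereal (d - h z) < f u"
    by (rule eventually_mono) (use fz in metis)
  moreover have "\<forall>\<^sub>F u in nhds z. h z - (d - d') < h u"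
    using h d'(2) by (intro order_tendstoD) (auto simp: isCont_def tendsto_at_iff_tendsto_nhds)
  ultimately show ?thesis
  proof eventually_elim
    case (elim u)
    then have "ereal d' < f u + ereal (h u)" by (cases "f u") auto
    with d'(1) show ?case by (rule less_trans)
  qed
qed

text \<open>If no point of \<open>K\<close> were minimal, each \<open>z\<close> would be beaten by some \<open>b z \<in> K\<close>, and by lower
  semicontinuity \<open>b z\<close> would beat a whole neighbourhood of \<open>z\<close>.  Among finitely many such
  neighbourhoods covering \<open>K\<close>, the best of the points \<open>b z\<close> would be beaten by another one of them.\<close>

lemma lsc_plus_continuous_attains_inf:
  fixes f :: "'a::t2_space \<Rightarrow> ereal" and h :: "'a \<Rightarrow> real"
  assumes lsc: "lsc f" and K: "compact K" "K \<noteq> {}" and h: "\<And>z. z \<in> K \<Longrightarrow> isCont h z"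
  obtains z where "z \<in> K" "\<And>x. x \<in> K \<Longrightarrow> f z + ereal (h z) \<le> f x + ereal (h x)"
proof (rule ccontr)
  let ?g = "\<lambda>z. f z + ereal (h z)"
  assume "\<not> thesis"
  then have "\<forall>z\<in>K. \<exists>x\<in>K. ?g x < ?g z"
    using that not_le by metis
  then obtain b where b: "\<And>z. z \<in> K \<Longrightarrow> b z \<in> K" "\<And>z. z \<in> K \<Longrightarrow> ?g (b z) < ?g z"
    by metis
  have "\<exists>U. open U \<and> z \<in> U \<and> (\<forall>u\<in>U. ?g (b z) < ?g u)" if "z \<in> K" for z
  proof -
    have "\<forall>\<^sub>F u in nhds z. ?g (b z) < ?g u"
      using lsc b(2)[OF that] h[OF that] unfolding lsc_def
      by (intro lsc_plus_continuous_eventually_greater) auto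
    then show ?thesis by (simp add: eventually_nhds)
  qed
  then obtain U where U: "\<And>z. z \<in> K \<Longrightarrow> open (U z)" "\<And>z. z \<in> K \<Longrightarrow> z \<in> U z"
    "\<And>z u. z \<in> K \<Longrightarrow> u \<in> U z \<Longrightarrow> ?g (b z) < ?g u"
    by metis
  obtain C where C: "C \<subseteq> K" "finite C" "K \<subseteq> (\<Union>z\<in>C. U z)"
    using compactE_image[OF K(1), of K U] U by blast
  have "C \<noteq> {}"
  proof
    assume "C = {}"
    with C(3) K(2) show False by simp
  qed
  then obtain a where a: "a \<in> C" "\<And>z. z \<in> C \<Longrightarrow> ?g (b a) \<le> ?g (b z)"
    using ex_is_arg_min_if_finite[OF C(2), of "\<lambda>z. ?g (b z)"]
    unfolding is_arg_min_def not_less[symmetric] by blast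
  have "b a \<in> K" using a(1) C(1) b(1) by blast
  then obtain z where z: "z \<in> C" "b a \<in> U z" using C(3) by blast
  then have "?g (b z) < ?g (b a)" using U(3) C(1) by blast
  with a(2)[OF z(1)] show False by simp
qed

text \<open>The difference quotient is at least \<open>- C * norm (x - z)\<close>, which tends to \<open>0\<close>.\<close>

lemma regular_subdiffI_quadratic:
  fixes f :: "'a::real_inner \<Rightarrow> ereal"
  assumes fin: "\<bar>f z\<bar> \<noteq> \<infinity>"
    and lower: "\<forall>\<^sub>F x in at z. f z + ereal (inner y (x - z) - C * (norm (x - z))\<^sup>2) \<le> f x"
  shows "y \<in> regular_subdiff f z"
proof -
  obtain a where a: "f z = ereal a" using fin by (cases "f z") auto
  have "0 \<le> Liminf (at z) (\<lambda>x. (f x - f z - ereal (inner y (x - z))) / ereal (norm (x - z)))"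
    unfolding le_Liminf_iff
  proof (intro allI impI)
    fix c :: ereal assume "c < 0"
    then obtain d where d: "c < ereal d" "d < 0" using ereal_dense2 by (metis ereal_less(1))
    have "((\<lambda>x. - C * norm (x - z)) \<longlongrightarrow> 0) (at z)" by (auto intro!: tendsto_eq_intros)
    then have "\<forall>\<^sub>F x in at z. d < - C * norm (x - z)" using d(2) by (rule order_tendstoD)
    with lower eventually_neq_at_within[of z z UNIV]
    show "\<forall>\<^sub>F x in at z. c < (f x - f z - ereal (inner y (x - z))) / ereal (norm (x - z))"
    proof eventually_elim
      case (elim x)
      then have n: "0 < norm (x - z)" by simp
      have "ereal d \<le> (f x - f z - ereal (inner y (x - z))) / ereal (norm (x - z))"
      proof (cases "f x")
        case (real b)
        have "d * norm (x - z) \<le> (- C * norm (x - z)) * norm (x - z)"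
          by (rule mult_right_mono) (use elim n in linarith)+
        also have "\<dots> \<le> b - a - inner y (x - z)"
          using elim(1) by (simp add: a real power2_eq_square mult_ac)
        finally show ?thesis using n by (simp add: a real pos_le_divide_eq)
      next
        case PInf
        then show ?thesis using n by (simp add: a divide_ereal_def)
      next
        case MInf
        then show ?thesis using elim(1) by (simp add: a)
      qed
      with d(1) show ?case by (rule less_le_trans)
    qed
  qed
  then show ?thesis unfolding regular_subdiff_def edom_def by (simp add: a)
qed

lemma regular_subset_limiting_subdiff: "regular_subdiff f z \<subseteq> limiting_subdiff f z"
proof
  fix y assume "y \<in> regular_subdiff f z"
  moreover from this have "z \<in> edom f" by (simp add: regular_subdiff_def)
  ultimately show "y \<in> limiting_subdiff f z"
    unfolding limiting_subdiff_def mem_Collect_eq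
    by (intro conjI exI[where x = "\<lambda>_. z"] exI[where x = "\<lambda>_. y"] allI tendsto_const)
qed

lemma eventually_scaled_norm_less:
  fixes a :: "'a::real_normed_vector"
  assumes "0 < e"
  shows "\<forall>\<^sub>F v in nhds a. c * norm (v - a) < e"
proof -
  have "isCont (\<lambda>v. c * norm (v - a)) a" by (intro continuous_intros)
  then have "((\<lambda>v. c * norm (v - a)) \<longlongrightarrow> c * norm (a - a)) (nhds a)"
    using tendsto_at_iff_tendsto_nhds[of "\<lambda>v. c * norm (v - a)" a] isCont_def by blast
  then show ?thesis by (rule order_tendstoD(2)) (use assms in simp)
qed

section \<open>Existence and location of proximal points\<close>

text \<open>One radius \<open>\<delta>\<close> serves for prox-regularity, for the localization of the minimizers and for the
  distance of \<open>vbar\<close> from \<open>zbar\<close>.  The argument \<open>v - z\<close> of the kernel is a sum of three displacements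
  of size at most \<open>\<delta>\<close>, so \<open>4 * \<delta> \<le> \<rho>\<close> keeps it where the kernel is strongly convex.  The bound
  \<open>lam * r < \<sigma>\<close> says that this strong convexity, scaled by \<open>1 / lam\<close>, outweighs the modulus \<open>r\<close> of
  prox-regularity.  The bound on \<open>lam * norm ybar\<close> puts \<open>lam *\<^sub>R ybar\<close> where the gradient of the kernel
  can be inverted inside the ball.  The last assumption excludes minimizers far from \<open>zbar\<close>.\<close>

locale prox_setting = local_kernel \<phi> \<rho> \<sigma> L
  for \<phi> :: "'a::euclidean_space \<Rightarrow> ereal" and \<rho> \<sigma> L :: real +
  fixes f :: "'a \<Rightarrow> ereal" and zbar ybar vbar :: 'a and lam \<delta> r \<eta> :: real
  assumes proper_f: "proper f" and lsc_f: "lsc f" and finite_zbar: "\<bar>f zbar\<bar> \<noteq> \<infinity>"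
    and ybar: "ybar \<in> limiting_subdiff f zbar"
    and subgradient_inequality: "norm (z - zbar) < \<delta> \<Longrightarrow> f z < f zbar + ereal \<delta> \<Longrightarrow>
      y \<in> limiting_subdiff f z \<Longrightarrow> norm (y - ybar) < \<delta> \<Longrightarrow> norm (z' - zbar) < \<delta> \<Longrightarrow>
      f z + ereal (inner y (z' - z)) - ereal (r / 2 * (norm (z' - z))\<^sup>2) \<le> f z'"
    and sizes: "0 < \<delta>" "4 * \<delta> \<le> \<rho>" "0 < lam" "lam * r < \<sigma>" "0 < \<eta>" "\<eta> \<le> \<delta>"
    and gradient_vbar: "gradient \<phi> (vbar - zbar) = lam *\<^sub>R ybar"
    and vbar_near: "norm (vbar - zbar) < \<delta>"
    and ybar_small: "lam * norm ybar < \<sigma> * \<delta> / 2"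
    and far: "norm (v - vbar) < \<eta> \<Longrightarrow> \<delta> \<le> norm (z - zbar) \<Longrightarrow>
      f zbar + ereal (1 / lam) * \<phi> (v - zbar) < f z + ereal (1 / lam) * \<phi> (v - z)"
begin

abbreviation F :: "'a \<Rightarrow> real" where "F z \<equiv> real_of_ereal (f z)"

abbreviation obj :: "'a \<Rightarrow> 'a \<Rightarrow> ereal" where
  "obj v z \<equiv> f z + ereal (1 / lam) * \<phi> (v - z)"

abbreviation P :: "'a \<Rightarrow> 'a set" where "P v \<equiv> prox \<phi> lam f v"

abbreviation T :: "real \<Rightarrow> 'a \<Rightarrow> 'a set" where
  "T \<epsilon> z \<equiv> attentive_localization f zbar ybar \<epsilon> z"

lemma mem_prox_iff: "z \<in> P v \<longleftrightarrow> (\<forall>x. obj v z \<le> obj v x)"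
  unfolding prox_def is_arg_min_def by (auto simp: not_less)

lemma displacement_in_ball:
  assumes "norm (v - vbar) < \<eta>" "norm (z - zbar) \<le> \<delta>"
  shows "norm (v - z) < \<rho>"
proof -
  have "v - z = (v - vbar) + (vbar - zbar) - (z - zbar)" by simp
  then have "norm (v - z) \<le> norm (v - vbar) + norm (vbar - zbar) + norm (z - zbar)"
    using norm_triangle_ineq4[of "(v - vbar) + (vbar - zbar)" "z - zbar"]
      norm_triangle_ineq[of "v - vbar" "vbar - zbar"] by simp
  then show ?thesis using assms vbar_near sizes by linarith
qed

lemma f_real: "\<bar>f z\<bar> \<noteq> \<infinity> \<Longrightarrow> f z = ereal (F z)"
  by (simp add: ereal_real')

lemma f_zbar: "f zbar = ereal (F zbar)"
  using finite_zbar by (rule f_real)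

lemma obj_real: "norm (v - z) < \<rho> \<Longrightarrow> obj v z = f z + ereal (\<Phi> (v - z) / lam)"
  by (subst kernel_real) simp_all

lemma lam_cancel: "x / lam \<le> y / lam \<longleftrightarrow> x \<le> y"
  using sizes by (simp add: divide_le_cancel)

text \<open>By the comparison with \<open>zbar\<close>, minimizers are near \<open>zbar\<close> and have finite values, so that
  the estimates below can be carried out in the reals.\<close>

lemma prox_near:
  assumes v: "norm (v - vbar) < \<eta>" and z: "z \<in> P v"
  shows "norm (z - zbar) < \<delta>" "f z = ereal (F z)" "norm (v - z) < \<rho>"
proof -
  have le: "obj v z \<le> obj v zbar" using z mem_prox_iff by blast
  then show near: "norm (z - zbar) < \<delta>" using far[OF v, of z] by (meson leD not_le)
  then show *: "norm (v - z) < \<rho>" by (intro displacement_in_ball[OF v]) simp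
  have "norm (v - zbar) < \<rho>" using sizes by (intro displacement_in_ball[OF v]) simp
  with * le have "f z + ereal (\<Phi> (v - z) / lam) \<le> f zbar + ereal (\<Phi> (v - zbar) / lam)"
    by (simp only: obj_real)
  also have "\<dots> < \<infinity>" by (subst f_zbar) simp
  finally
  have "f z \<noteq> \<infinity>" by auto
  moreover have "f z \<noteq> -\<infinity>" using proper_f unfolding proper_def by (metis less_irrefl)
  ultimately show "f z = ereal (F z)" by (intro f_real) auto
qed

lemma prox_le_real:
  assumes v: "norm (v - vbar) < \<eta>" and z: "z \<in> P v"
    and x: "norm (x - zbar) \<le> \<delta>" "f x = ereal (F x)"
  shows "F z + \<Phi> (v - z) / lam \<le> F x + \<Phi> (v - x) / lam"
proof -
  have "obj v z \<le> obj v x" using z mem_prox_iff by blast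
  then have "f z + ereal (\<Phi> (v - z) / lam) \<le> f x + ereal (\<Phi> (v - x) / lam)"
    using obj_real[OF prox_near(3)[OF v z]] obj_real[OF displacement_in_ball[OF v x(1)]] by simp
  then show ?thesis
    by (subst (asm) prox_near(2)[OF v z], subst (asm) x(2)) simp
qed

text \<open>The minimum over the closed ball of radius \<open>\<delta>\<close> around \<open>zbar\<close> exists by compactness, and it is
  global because points outside are worse than \<open>zbar\<close>.\<close>

lemma prox_nonempty:
  assumes v: "norm (v - vbar) < \<eta>"
  shows "P v \<noteq> {}"
proof -
  have c: "isCont (\<lambda>z. \<Phi> (v - z) / lam) z" if "z \<in> cball zbar \<delta>" for z
  proof -
    have "norm (v - z) < \<rho>"
      using that by (intro displacement_in_ball[OF v]) (simp add: dist_norm norm_minus_commute)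
    then have "isCont (\<lambda>z. \<Phi> (v - z)) z"
      by (intro isCont_o2[OF _ kernel_continuous]) auto
    then show ?thesis by (intro continuous_intros) (use sizes in auto)
  qed
  obtain z where z: "z \<in> cball zbar \<delta>"
    "\<And>x. x \<in> cball zbar \<delta> \<Longrightarrow> f z + ereal (\<Phi> (v - z) / lam) \<le> f x + ereal (\<Phi> (v - x) / lam)"
    using lsc_plus_continuous_attains_inf[OF lsc_f compact_cball[of zbar \<delta>] _ c] sizes by auto
  have in_ball: "obj v z \<le> obj v x" if "norm (x - zbar) \<le> \<delta>" for x
  proof -
    have x: "x \<in> cball zbar \<delta>" using that by (simp add: dist_norm norm_minus_commute)
    have "norm (v - z) < \<rho>"
      using z(1) by (intro displacement_in_ball[OF v]) (simp add: dist_norm norm_minus_commute)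
    with z(2)[OF x] displacement_in_ball[OF v that] show ?thesis by (simp only: obj_real)
  qed
  have "obj v z \<le> obj v x" for x
  proof (cases "norm (x - zbar) \<le> \<delta>")
    case False
    then have "\<delta> \<le> norm (x - zbar)" by simp
    then have "obj v zbar < obj v x" by (rule far[OF v])
    moreover have "obj v z \<le> obj v zbar" using sizes by (intro in_ball) simp
    ultimately show ?thesis by simp
  qed (rule in_ball)
  then show ?thesis using mem_prox_iff by blast
qed

lemma T_subgradient_inequality:
  assumes y: "y \<in> T \<delta> z" and z': "norm (z' - zbar) < \<delta>" and fin: "f z' = ereal (F z')"
  shows "f z = ereal (F z)" "F z + inner y (z' - z) - r / 2 * (norm (z' - z))\<^sup>2 \<le> F z'"
proof -
  have *: "norm (z - zbar) < \<delta>" "f z < f zbar + ereal \<delta>" "y \<in> limiting_subdiff f z"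
    "norm (y - ybar) < \<delta>"
    using y unfolding attentive_localization_def by (auto split: if_splits)
  have "f z \<noteq> \<infinity>" using *(2) by auto
  moreover have "f z \<noteq> -\<infinity>" using proper_f unfolding proper_def by (metis less_irrefl)
  ultimately show fz: "f z = ereal (F z)" by (intro f_real) auto
  show "F z + inner y (z' - z) - r / 2 * (norm (z' - z))\<^sup>2 \<le> F z'"
    using subgradient_inequality[OF * z']
    by (subst (asm) fz, subst (asm) fin) simp
qed

lemma ybar_in_T: "0 < \<epsilon> \<Longrightarrow> ybar \<in> T \<epsilon> zbar"
  unfolding attentive_localization_def using ybar finite_zbar by (cases "f zbar") auto

lemma multiply_by_lam:
  assumes "x / lam \<le> y / lam + c"
  shows "x \<le> y + lam * c"
  using assms sizes by (simp add: field_simps)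

text \<open>Add the prox-regularity inequality at \<open>(zbar, ybar)\<close>, strong convexity of the kernel at
  \<open>v - zbar\<close>, and the optimality of \<open>z\<close> against \<open>zbar\<close>.  The quadratic terms leave
  \<open>(\<sigma> - lam * r) / 2 * (norm (z - zbar))\<^sup>2\<close>, and the linear terms cancel up to the variation of the
  gradient of the kernel between \<open>vbar - zbar\<close> and \<open>v - zbar\<close>.\<close>

lemma prox_displacement:
  assumes v: "norm (v - vbar) < \<eta>" and z: "z \<in> P v"
  shows "norm (z - zbar) \<le> 2 * L / (\<sigma> - lam * r) * norm (v - vbar)"
proof (cases "z = zbar")
  case True
  then show ?thesis using pos sizes by simp
next
  case False
  let ?d = "z - zbar" and ?w = "v - zbar"
  have w: "norm ?w < \<rho>" using sizes by (intro displacement_in_ball[OF v]) simp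
  have wbar: "norm (vbar - zbar) < \<rho>" using vbar_near sizes by linarith
  note near = prox_near[OF v z]
  have "F zbar + inner ybar ?d - r / 2 * (norm ?d)\<^sup>2 \<le> F z"
    using T_subgradient_inequality(2)[OF ybar_in_T near(1,2)] sizes by simp
  moreover have "F z + \<Phi> (v - z) / lam \<le> F zbar + \<Phi> ?w / lam"
    using sizes by (intro prox_le_real[OF v z _ f_zbar]) simp
  ultimately have "\<Phi> (v - z) / lam \<le> \<Phi> ?w / lam + (r / 2 * (norm ?d)\<^sup>2 - inner ybar ?d)"
    by linarith
  then have "\<Phi> (v - z) \<le> \<Phi> ?w + lam * (r / 2 * (norm ?d)\<^sup>2 - inner ybar ?d)"
    by (rule multiply_by_lam)
  moreover have "\<Phi> ?w - inner (gradient \<phi> ?w) ?d + \<sigma> / 2 * (norm ?d)\<^sup>2 \<le> \<Phi> (v - z)"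
    using strongly_convex[OF w near(3)] by (simp add: norm_minus_commute inner_diff_right)
  moreover have "(\<sigma> - lam * r) / 2 * (norm ?d)\<^sup>2
      = \<sigma> / 2 * (norm ?d)\<^sup>2 - lam * (r / 2 * (norm ?d)\<^sup>2)"
    by (simp add: field_simps)
  ultimately have "(\<sigma> - lam * r) / 2 * (norm ?d)\<^sup>2 \<le> inner (gradient \<phi> ?w - lam *\<^sub>R ybar) ?d"
    by (simp add: right_diff_distrib inner_diff_left)
  also have "\<dots> \<le> norm (gradient \<phi> ?w - gradient \<phi> (vbar - zbar)) * norm ?d"
    unfolding gradient_vbar by (rule norm_cauchy_schwarz)
  also have "\<dots> \<le> (L * norm (v - vbar)) * norm ?d"
    using gradient_lipschitz[OF w wbar] by (intro mult_right_mono) auto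
  finally have "(\<sigma> - lam * r) / 2 * norm ?d \<le> L * norm (v - vbar)"
    using False by (simp add: power2_eq_square)
  then show ?thesis using sizes by (simp add: field_simps)
qed

lemma prox_vbar: "P vbar = {zbar}"
proof -
  have v: "norm (vbar - vbar) < \<eta>" using sizes by simp
  have "z = zbar" if "z \<in> P vbar" for z
    using prox_displacement[OF v that] by simp
  with prox_nonempty[OF v] show ?thesis by blast
qed

text \<open>Fermat's rule: minimality bounds \<open>f x - f z\<close> below by the negative increment of the kernel,
  whose first-order part is the asserted subgradient and whose remainder is quadratic since the gradient
  of the kernel is Lipschitz.\<close>

lemma prox_subgradient:
  assumes v: "norm (v - vbar) < \<eta>" and z: "z \<in> P v"
  shows "(1 / lam) *\<^sub>R gradient \<phi> (v - z) \<in> regular_subdiff f z"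
proof (rule regular_subdiffI_quadratic)
  note near = prox_near[OF v z]
  show "\<bar>f z\<bar> \<noteq> \<infinity>" by (subst near(2)) simp
  have "\<forall>\<^sub>F x in nhds z. norm (x - zbar) < \<delta>"
  proof (rule eventually_mono)
    show "\<forall>\<^sub>F x in nhds z. 1 * norm (x - z) < \<delta> - norm (z - zbar)"
      by (rule eventually_scaled_norm_less) (use near(1) in simp)
    show "norm (x - zbar) < \<delta>" if "1 * norm (x - z) < \<delta> - norm (z - zbar)" for x
      using that norm_triangle_ineq[of "x - z" "z - zbar"] by simp
  qed
  then have "\<forall>\<^sub>F x in at z. norm (x - zbar) < \<delta>"
    unfolding eventually_at_filter by (rule eventually_mono) simp
  then show "\<forall>\<^sub>F x in at z. f z + ereal (inner ((1 / lam) *\<^sub>R gradient \<phi> (v - z)) (x - z)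
      - L / lam * (norm (x - z))\<^sup>2) \<le> f x"
  proof (rule eventually_mono)
    fix x assume x: "norm (x - zbar) < \<delta>"
    show "f z + ereal (inner ((1 / lam) *\<^sub>R gradient \<phi> (v - z)) (x - z)
      - L / lam * (norm (x - z))\<^sup>2) \<le> f x"
    proof (cases "f x = \<infinity>")
      case False
      moreover have "f x \<noteq> -\<infinity>" using proper_f unfolding proper_def by (metis less_irrefl)
      ultimately have fx: "f x = ereal (F x)" by (intro f_real) auto
      have vx: "norm (v - x) < \<rho>" using x by (intro displacement_in_ball[OF v]) simp
      have "F z + \<Phi> (v - z) / lam \<le> F x + \<Phi> (v - x) / lam"
        using x by (intro prox_le_real[OF v z _ fx]) simp
      then have "\<Phi> (v - z) / lam \<le> \<Phi> (v - x) / lam + (F x - F z)" by linarith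
      then have 1: "\<Phi> (v - z) \<le> \<Phi> (v - x) + lam * (F x - F z)" by (rule multiply_by_lam)
      have "\<Phi> (v - x) + inner (gradient \<phi> (v - x)) (x - z) \<le> \<Phi> (v - z)"
        using gradient_inequality_real[OF vx near(3)] by simp
      moreover have "inner (gradient \<phi> (v - z) - gradient \<phi> (v - x)) (x - z)
          \<le> L * norm (x - z) * norm (x - z)"
        using gradient_lipschitz[OF near(3) vx]
        by (intro order_trans[OF norm_cauchy_schwarz] mult_right_mono) auto
      ultimately have "inner (gradient \<phi> (v - z)) (x - z) - L * (norm (x - z))\<^sup>2 \<le> lam * (F x - F z)"
        using 1 by (simp add: inner_diff_left power2_eq_square)
      then have "inner ((1 / lam) *\<^sub>R gradient \<phi> (v - z)) (x - z) - L / lam * (norm (x - z))\<^sup>2 \<le> F x - F z"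
        using sizes by (simp add: field_simps)
      then show ?thesis by (subst near(2), subst fx) simp
    qed simp
  qed
qed

text \<open>All three smallness conditions in the localization, including the one on the values of
  \<open>f\<close>, hold because the quantities involved are bounded by an error proportional to \<open>norm (v - vbar)\<close>.\<close>

lemma prox_attentive:
  assumes \<epsilon>: "0 < \<epsilon>"
  shows "\<forall>\<^sub>F v in nhds vbar. norm (v - vbar) < \<eta> \<and>
    (\<forall>z\<in>P v. (1 / lam) *\<^sub>R gradient \<phi> (v - z) \<in> T \<epsilon> z)"
proof -
  define K where "K = 2 * L / (\<sigma> - lam * r)"
  have K: "0 \<le> K" using pos sizes by (simp add: K_def)
  have small: "\<forall>\<^sub>F v in nhds vbar. c * norm (v - vbar) < \<epsilon>" for c
    by (rule eventually_scaled_norm_less[OF \<epsilon>])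
  have "\<forall>\<^sub>F v in nhds vbar. norm (v - vbar) < \<eta>"
    using eventually_scaled_norm_less[of \<eta> 1 vbar] sizes by simp
  then show ?thesis
    using small[of K] small[of "L * \<rho> * K / lam"] small[of "L * (1 + K) / lam"]
  proof eventually_elim
    case (elim v)
    note v = elim(1)
    have "(1 / lam) *\<^sub>R gradient \<phi> (v - z) \<in> T \<epsilon> z" if z: "z \<in> P v" for z
    proof -
      note near = prox_near[OF v z]
      have dz: "norm (z - zbar) \<le> K * norm (v - vbar)"
        unfolding K_def by (rule prox_displacement[OF v z])
      have w: "norm (v - zbar) < \<rho>" using sizes by (intro displacement_in_ball[OF v]) simp
      have wbar: "norm (vbar - zbar) < \<rho>" using vbar_near sizes by linarith
      have "F z + \<Phi> (v - z) / lam \<le> F zbar + \<Phi> (v - zbar) / lam"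
        using sizes by (intro prox_le_real[OF v z _ f_zbar]) simp
      then have "F z \<le> F zbar + (\<Phi> (v - zbar) - \<Phi> (v - z)) / lam"
        by (simp add: diff_divide_distrib)
      moreover have "\<Phi> (v - zbar) - \<Phi> (v - z) \<le> inner (gradient \<phi> (v - zbar)) (z - zbar)"
        using gradient_inequality_real[OF w near(3)] by (simp add: inner_diff_right)
      moreover have "\<dots> \<le> (L * \<rho>) * (K * norm (v - vbar))"
      proof (intro order_trans[OF norm_cauchy_schwarz] mult_mono dz)
        have "norm (gradient \<phi> (v - zbar)) \<le> L * norm (v - zbar)"
          using gradient_lipschitz[OF w, of 0] pos by simp
        also have "\<dots> \<le> L * \<rho>" using w pos by (intro mult_left_mono) auto
        finally show "norm (gradient \<phi> (v - zbar)) \<le> L * \<rho>" .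
      qed (use pos in auto)
      ultimately have "F z \<le> F zbar + L * \<rho> * K / lam * norm (v - vbar)"
        using sizes by (smt (verit) divide_right_mono mult.assoc times_divide_eq_left)
      also have "\<dots> < F zbar + \<epsilon>" using elim by simp
      finally have fz: "f z < f zbar + ereal \<epsilon>"
        by (subst near(2), subst f_zbar) simp
      have "norm (gradient \<phi> (v - z) - gradient \<phi> (vbar - zbar)) \<le> L * norm ((v - z) - (vbar - zbar))"
        by (rule gradient_lipschitz[OF near(3) wbar])
      also have "(v - z) - (vbar - zbar) = (v - vbar) - (z - zbar)" by simp
      also have "L * norm \<dots> \<le> L * ((1 + K) * norm (v - vbar))"
        using dz pos by (intro mult_left_mono order_trans[OF norm_triangle_ineq4])
          (auto simp: algebra_simps)
      finally have "norm (gradient \<phi> (v - z) - lam *\<^sub>R ybar) / lam \<le> L * (1 + K) / lam * norm (v - vbar)"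
        unfolding gradient_vbar using sizes by (simp add: field_simps)
      moreover have "(1 / lam) *\<^sub>R gradient \<phi> (v - z) - ybar
          = (1 / lam) *\<^sub>R (gradient \<phi> (v - z) - lam *\<^sub>R ybar)"
        using sizes by (simp add: algebra_simps)
      ultimately have "norm ((1 / lam) *\<^sub>R gradient \<phi> (v - z) - ybar) < \<epsilon>"
        using elim sizes by simp
      moreover have "(1 / lam) *\<^sub>R gradient \<phi> (v - z) \<in> limiting_subdiff f z"
        using prox_subgradient[OF v z] regular_subset_limiting_subdiff by blast
      moreover have "norm (z - zbar) < \<epsilon>" using dz elim by linarith
      ultimately show ?thesis using fz unfolding attentive_localization_def by simp
    qed
    with v show ?case by blast
  qed
qed

section \<open>The proximal mapping as a Lipschitz inverse\<close>

text \<open>Adding the prox-regularity inequalities at the two minimizers shows that the subgradients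
  from Fermat's rule are hypomonotone with constant \<open>r\<close>.  Moving only the minimizer in the argument of
  the kernel produces strong monotonicity of the opposite sign; moving only \<open>v\<close> costs the Lipschitz
  constant.  For \<open>v1 = v2\<close> this is uniqueness.\<close>

lemma prox_two_point:
  assumes v1: "norm (v1 - vbar) < \<eta>" and v2: "norm (v2 - vbar) < \<eta>"
    and z1: "z1 \<in> P v1" "(1 / lam) *\<^sub>R gradient \<phi> (v1 - z1) \<in> T \<delta> z1"
    and z2: "z2 \<in> P v2" "(1 / lam) *\<^sub>R gradient \<phi> (v2 - z2) \<in> T \<delta> z2"
  shows "norm (z1 - z2) \<le> L / (\<sigma> - lam * r) * norm (v1 - v2)"
proof (cases "z1 = z2")
  case True
  then show ?thesis using pos sizes by simp
next
  case False
  let ?g1 = "gradient \<phi> (v1 - z1)" and ?g2 = "gradient \<phi> (v2 - z2)" and ?g = "gradient \<phi> (v1 - z2)"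
  let ?d = "z1 - z2"
  note near1 = prox_near[OF v1 z1(1)] and near2 = prox_near[OF v2 z2(1)]
  have m: "norm (v1 - z2) < \<rho>" using near2(1) by (intro displacement_in_ball[OF v1]) simp
  have "F z1 + inner ((1 / lam) *\<^sub>R ?g1) (z2 - z1) - r / 2 * (norm (z2 - z1))\<^sup>2 \<le> F z2"
    by (rule T_subgradient_inequality(2)[OF z1(2) near2(1,2)])
  moreover have "F z2 + inner ((1 / lam) *\<^sub>R ?g2) (z1 - z2) - r / 2 * (norm (z1 - z2))\<^sup>2 \<le> F z1"
    by (rule T_subgradient_inequality(2)[OF z2(2) near1(1,2)])
  ultimately have "- (r * (norm ?d)\<^sup>2) \<le> inner (?g1 - ?g2) ?d / lam"
    by (simp add: norm_minus_commute[of z2] inner_diff_left inner_diff_right diff_divide_distrib)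
  then have "- (lam * r * (norm ?d)\<^sup>2) \<le> inner (?g1 - ?g2) ?d"
    using sizes by (simp add: field_simps)
  also have "\<dots> = inner (?g1 - ?g) ?d + inner (?g - ?g2) ?d"
    by (simp add: inner_diff_left)
  also have "inner (?g1 - ?g) ?d \<le> - (\<sigma> * (norm ?d)\<^sup>2)"
    using strongly_monotone[OF near1(3) m] by (simp add: norm_minus_commute inner_diff_right)
  also have "inner (?g - ?g2) ?d \<le> L * norm (v1 - v2) * norm ?d"
    using gradient_lipschitz[OF m near2(3)]
    by (intro order_trans[OF norm_cauchy_schwarz] mult_right_mono) auto
  finally have "(\<sigma> - lam * r) * norm ?d * norm ?d \<le> L * norm (v1 - v2) * norm ?d"
    by (simp add: algebra_simps power2_eq_square)
  then have "(\<sigma> - lam * r) * norm ?d \<le> L * norm (v1 - v2)"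
    using False by simp
  then show ?thesis using sizes by (simp add: field_simps)
qed

text \<open>A localized subgradient inequality and strong convexity of the kernel together say that
  \<open>v - w\<close> is at least as good as any point of the \<open>\<delta>\<close>-ball, in particular as good as an actual minimizer.\<close>

lemma prox_if_localized:
  assumes v: "norm (v - vbar) < \<eta>" and w: "norm w < \<rho>"
    and y: "y \<in> T \<delta> (v - w)" and grad: "gradient \<phi> w = lam *\<^sub>R y"
  shows "v - w \<in> P v"
proof -
  let ?z = "v - w"
  obtain x where x: "x \<in> P v" using prox_nonempty[OF v] by blast
  note near = prox_near[OF v x]
  note T = T_subgradient_inequality[OF y near(1,2)]
  have "\<Phi> w + inner (lam *\<^sub>R y) (?z - x) + \<sigma> / 2 * (norm (x - ?z))\<^sup>2 \<le> \<Phi> (v - x)"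
    using strongly_convex[OF w near(3)] grad by (simp add: algebra_simps norm_minus_commute)
  moreover have "lam * r / 2 * (norm (x - ?z))\<^sup>2 \<le> \<sigma> / 2 * (norm (x - ?z))\<^sup>2"
    using sizes by (intro mult_right_mono) auto
  ultimately have "\<Phi> w + lam * (r / 2 * (norm (x - ?z))\<^sup>2 - inner y (x - ?z)) \<le> \<Phi> (v - x)"
    by (simp add: algebra_simps)
  then have "(\<Phi> w + lam * (r / 2 * (norm (x - ?z))\<^sup>2 - inner y (x - ?z))) / lam \<le> \<Phi> (v - x) / lam"
    by (simp only: lam_cancel)
  then have "\<Phi> w / lam + (r / 2 * (norm (x - ?z))\<^sup>2 - inner y (x - ?z)) \<le> \<Phi> (v - x) / lam"
    using sizes by (simp add: add_divide_distrib)
  then have "F ?z + \<Phi> w / lam \<le> F x + \<Phi> (v - x) / lam"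
    using T(2) by linarith
  then have "f ?z + ereal (\<Phi> w / lam) \<le> f x + ereal (\<Phi> (v - x) / lam)"
    by (subst T(1), subst near(2)) simp
  then have "obj v ?z \<le> obj v x"
    using obj_real[OF near(3)] obj_real[of v ?z] w by simp
  then show ?thesis using x unfolding mem_prox_iff by (meson order_trans)
qed

text \<open>The equation \<open>v = z + gradient (conjugate \<phi>) (lam *\<^sub>R y)\<close> is a rewriting of
  \<open>lam *\<^sub>R y = gradient \<phi> (v - z)\<close>, i.e. of Fermat's rule.  The radius \<open>\<epsilon>\<close> is chosen so small that all
  \<open>lam *\<^sub>R y\<close> with \<open>y\<close> in the localization lie where the gradient of the kernel has a local inverse.\<close>

lemma prox_eq_inverse:
  "\<exists>\<epsilon>>0. \<forall>\<^sub>F v in nhds vbar. P v = set_valued_inverse (id_plus_grad_conj \<phi> lam (T \<epsilon>)) v"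
proof -
  define c where "c = \<sigma> * \<delta> / 2 - lam * norm ybar"
  define \<epsilon> where "\<epsilon> = min \<delta> (c / (2 * lam))"
  have c: "0 < c" using ybar_small by (simp add: c_def)
  have \<epsilon>: "0 < \<epsilon>" "\<epsilon> \<le> \<delta>" using sizes c by (auto simp: \<epsilon>_def)
  have "lam * \<epsilon> \<le> lam * (c / (2 * lam))"
    using sizes by (intro mult_left_mono) (auto simp: \<epsilon>_def)
  then have "lam * \<epsilon> < c" using sizes c by simp
  then have small: "norm (lam *\<^sub>R y) < \<sigma> * \<delta> / 2" if "y \<in> T \<epsilon> z" for y z
  proof -
    have "norm (y - ybar) < \<epsilon>"
      using that unfolding attentive_localization_def by (auto split: if_splits)
    then have "norm y \<le> norm ybar + \<epsilon>"
      using norm_triangle_ineq2[of y ybar] by linarith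
    then have "lam * norm y \<le> lam * norm ybar + lam * \<epsilon>"
      using sizes mult_left_mono[of "norm y" "norm ybar + \<epsilon>" lam] by (simp add: algebra_simps)
    then show ?thesis using \<open>lam * \<epsilon> < c\<close> sizes by (simp add: c_def)
  qed
  have \<delta>\<rho>: "\<delta> < \<rho>" using sizes by linarith
  have mono: "T \<epsilon> z \<subseteq> T \<delta> z" for z
  proof
    fix y assume y: "y \<in> T \<epsilon> z"
    have "f zbar + ereal \<epsilon> \<le> f zbar + ereal \<delta>" using \<epsilon> by (intro add_left_mono) simp
    then show "y \<in> T \<delta> z"
      using y \<epsilon>(2) unfolding attentive_localization_def
      by (auto split: if_splits dest: less_le_trans)
  qed
  have conj: "gradient (conjugate \<phi>) (gradient \<phi> w) = w"
    if "norm w < \<rho>" "norm (gradient \<phi> w) < \<sigma> * \<delta> / 2" for w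
    by (rule gradient_eq[OF has_gradient_conjugate[OF sizes(1) \<delta>\<rho> that]])
  have "\<forall>\<^sub>F v in nhds vbar. P v = set_valued_inverse (id_plus_grad_conj \<phi> lam (T \<epsilon>)) v"
    using prox_attentive[OF \<epsilon>(1)]
  proof (rule eventually_mono)
    fix v
    assume v: "norm (v - vbar) < \<eta> \<and> (\<forall>z\<in>P v. (1 / lam) *\<^sub>R gradient \<phi> (v - z) \<in> T \<epsilon> z)"
    show "P v = set_valued_inverse (id_plus_grad_conj \<phi> lam (T \<epsilon>)) v"
    proof (intro equalityI subsetI)
      fix z assume z: "z \<in> P v"
      let ?y = "(1 / lam) *\<^sub>R gradient \<phi> (v - z)"
      have y: "?y \<in> T \<epsilon> z" using v z by blast
      have ly: "lam *\<^sub>R ?y = gradient \<phi> (v - z)" using sizes by simp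
      have "norm (v - z) < \<rho>" using v z prox_near(3) by blast
      then have "gradient (conjugate \<phi>) (lam *\<^sub>R ?y) = v - z"
        using conj small[OF y] unfolding ly by blast
      then have "v = z + gradient (conjugate \<phi>) (lam *\<^sub>R ?y)" by simp
      then show "z \<in> set_valued_inverse (id_plus_grad_conj \<phi> lam (T \<epsilon>)) v"
        using y unfolding set_valued_inverse_def id_plus_grad_conj_def by blast
    next
      fix z assume "z \<in> set_valued_inverse (id_plus_grad_conj \<phi> lam (T \<epsilon>)) v"
      then obtain y where y: "y \<in> T \<epsilon> z" "v = z + gradient (conjugate \<phi>) (lam *\<^sub>R y)"
        unfolding set_valued_inverse_def id_plus_grad_conj_def by blast
      obtain w where w: "norm w < \<delta>" "gradient \<phi> w = lam *\<^sub>R y"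
        using gradient_attains_small[OF sizes(1) \<delta>\<rho> small[OF y(1)]] by blast
      have w\<rho>: "norm w < \<rho>" using w \<delta>\<rho> by linarith
      have "gradient (conjugate \<phi>) (lam *\<^sub>R y) = w"
        using conj[OF w\<rho>] small[OF y(1)] w(2) by simp
      then have z: "z = v - w" using y(2) by simp
      then have "v - w \<in> P v"
        using v mono y(1) by (intro prox_if_localized[OF _ w\<rho> _ w(2)]) auto
      with z show "z \<in> P v" by simp
    qed
  qed
  with \<epsilon>(1) show ?thesis by blast
qed

lemma prox_selection:
  obtains \<tau> p where "0 < \<tau>" "\<tau> \<le> \<eta>" "\<forall>v\<in>ball vbar \<tau>. P v = {p v}"
    "(L / (\<sigma> - lam * r))-lipschitz_on (ball vbar \<tau>) p"
proof -
  obtain t where t: "0 < t" "\<And>v. dist v vbar < t \<Longrightarrow> norm (v - vbar) < \<eta> \<and>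
      (\<forall>z\<in>P v. (1 / lam) *\<^sub>R gradient \<phi> (v - z) \<in> T \<delta> z)"
    using prox_attentive[OF sizes(1)] unfolding eventually_nhds_metric by blast
  define \<tau> where "\<tau> = min t \<eta>"
  have \<tau>: "0 < \<tau>" "\<tau> \<le> \<eta>" using t(1) sizes by (auto simp: \<tau>_def)
  have v: "norm (v - vbar) < \<eta>" "\<And>z. z \<in> P v \<Longrightarrow> (1 / lam) *\<^sub>R gradient \<phi> (v - z) \<in> T \<delta> z"
    if "v \<in> ball vbar \<tau>" for v
    using t(2)[of v] that by (auto simp: \<tau>_def dist_commute)
  define p where "p v = (SOME z. z \<in> P v)" for v
  have p: "p v \<in> P v" if "v \<in> ball vbar \<tau>" for v
    unfolding p_def using prox_nonempty[OF v(1)[OF that]] some_in_eq by blast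
  have two: "norm (z1 - z2) \<le> L / (\<sigma> - lam * r) * norm (v1 - v2)"
    if "v1 \<in> ball vbar \<tau>" "v2 \<in> ball vbar \<tau>" "z1 \<in> P v1" "z2 \<in> P v2" for v1 v2 z1 z2
    using prox_two_point[OF v(1)[OF that(1)] v(1)[OF that(2)] that(3) v(2)[OF that(1,3)]
        that(4) v(2)[OF that(2,4)]] .
  show ?thesis
  proof (rule that[OF \<tau>])
    show "\<forall>v\<in>ball vbar \<tau>. P v = {p v}"
      using p two[OF _ _ _ p] by fastforce
    show "(L / (\<sigma> - lam * r))-lipschitz_on (ball vbar \<tau>) p"
      by (rule lipschitz_onI) (use two p pos sizes in \<open>auto simp: dist_norm\<close>)
  qed
qed

section \<open>The gradient of the envelope\<close>

lemma envelope_prox: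
  assumes "z \<in> P v"
  shows "envelope \<phi> lam f v = obj v z"
  unfolding envelope_def using assms unfolding mem_prox_iff
  by (intro antisym INF_lower INF_greatest) auto

text \<open>Use the minimizer \<open>z\<close> for \<open>v\<close> as a competitor for \<open>u\<close>: the values of \<open>f\<close> cancel and only an
  increment of the kernel remains.  Exchanging the roles of \<open>u\<close> and \<open>v\<close> gives a lower bound.\<close>

lemma envelope_increment:
  assumes u: "norm (u - vbar) < \<eta>" and v: "norm (v - vbar) < \<eta>" and z: "z \<in> P v" and x: "x \<in> P u"
  shows "real_of_ereal (envelope \<phi> lam f u) - real_of_ereal (envelope \<phi> lam f v)
    \<le> inner ((1 / lam) *\<^sub>R gradient \<phi> (v - z)) (u - v) + L / lam * (norm (u - v))\<^sup>2"
proof -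
  note near = prox_near[OF v z] and near' = prox_near[OF u x]
  have uz: "norm (u - z) < \<rho>" using near(1) by (intro displacement_in_ball[OF u]) simp
  have ev: "envelope \<phi> lam f v = ereal (F z + \<Phi> (v - z) / lam)"
    unfolding envelope_prox[OF z] obj_real[OF near(3)] by (subst near(2)) simp
  have eu: "envelope \<phi> lam f u = ereal (F x + \<Phi> (u - x) / lam)"
    unfolding envelope_prox[OF x] obj_real[OF near'(3)] by (subst near'(2)) simp
  have "F x + \<Phi> (u - x) / lam \<le> F z + \<Phi> (u - z) / lam"
    using near by (intro prox_le_real[OF u x]) auto
  moreover have "\<Phi> (u - z) - \<Phi> (v - z)
      \<le> inner (gradient \<phi> (v - z)) (u - v) + L * (norm (u - v))\<^sup>2"
  proof -
    have "\<Phi> (u - z) - \<Phi> (v - z) \<le> inner (gradient \<phi> (u - z)) (u - v)"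
      using gradient_inequality_real[OF uz near(3)] by (simp add: inner_diff_right)
    moreover have "inner (gradient \<phi> (u - z) - gradient \<phi> (v - z)) (u - v)
        \<le> L * norm (u - v) * norm (u - v)"
      using gradient_lipschitz[OF uz near(3)]
      by (intro order_trans[OF norm_cauchy_schwarz] mult_right_mono) auto
    ultimately show ?thesis by (simp add: inner_diff_left power2_eq_square)
  qed
  then have "(\<Phi> (u - z) - \<Phi> (v - z)) / lam
      \<le> (inner (gradient \<phi> (v - z)) (u - v) + L * (norm (u - v))\<^sup>2) / lam"
    by (simp only: lam_cancel)
  ultimately show ?thesis
    unfolding eu ev by (simp add: add_divide_distrib diff_divide_distrib)
qed

lemma gradient_envelope_lipschitz:
  assumes \<tau>: "\<tau> \<le> \<eta>" and p: "\<And>v. v \<in> ball vbar \<tau> \<Longrightarrow> P v = {p v}"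
    and lip: "K-lipschitz_on (ball vbar \<tau>) p"
  shows "(L * (1 + K) / lam)-lipschitz_on (ball vbar \<tau>) (\<lambda>v. (1 / lam) *\<^sub>R gradient \<phi> (v - p v))"
proof (rule lipschitz_onI)
  have K: "0 \<le> K" using lip by (rule lipschitz_on_nonneg)
  then show "0 \<le> L * (1 + K) / lam" using pos sizes by simp
  have r: "norm (u - p u) < \<rho>" if "u \<in> ball vbar \<tau>" for u
  proof (rule prox_near(3))
    show "norm (u - vbar) < \<eta>" using that \<tau> by (simp add: dist_norm norm_minus_commute)
    show "p u \<in> P u" using p[OF that] by simp
  qed
  fix u v assume u: "u \<in> ball vbar \<tau>" and v: "v \<in> ball vbar \<tau>"
  have "norm (gradient \<phi> (u - p u) - gradient \<phi> (v - p v)) \<le> L * norm ((u - p u) - (v - p v))"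
    by (rule gradient_lipschitz[OF r[OF u] r[OF v]])
  also have "\<dots> \<le> L * ((1 + K) * norm (u - v))"
  proof (rule mult_left_mono)
    have "norm ((u - p u) - (v - p v)) \<le> norm (u - v) + norm (p u - p v)"
      using norm_triangle_ineq4[of "u - v" "p u - p v"] by (simp add: algebra_simps)
    also have "norm (p u - p v) \<le> K * norm (u - v)"
      using lipschitz_onD[OF lip u v] by (simp add: dist_norm)
    finally show "norm ((u - p u) - (v - p v)) \<le> (1 + K) * norm (u - v)"
      by (simp add: algebra_simps)
  qed (use pos in simp)
  finally have "norm (gradient \<phi> (u - p u) - gradient \<phi> (v - p v)) / lam
      \<le> L * ((1 + K) * norm (u - v)) / lam"
    by (simp only: lam_cancel)
  moreover have "dist ((1 / lam) *\<^sub>R gradient \<phi> (u - p u)) ((1 / lam) *\<^sub>R gradient \<phi> (v - p v))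
      = norm (gradient \<phi> (u - p u) - gradient \<phi> (v - p v)) / lam"
    using sizes by (simp add: dist_norm flip: scaleR_diff_right)
  ultimately show "dist ((1 / lam) *\<^sub>R gradient \<phi> (u - p u)) ((1 / lam) *\<^sub>R gradient \<phi> (v - p v))
      \<le> L * (1 + K) / lam * dist u v"
    by (simp add: dist_norm mult.assoc)
qed

lemma has_gradient_envelope:
  assumes \<tau>: "\<tau> \<le> \<eta>" and p: "\<And>v. v \<in> ball vbar \<tau> \<Longrightarrow> P v = {p v}"
    and lip: "K-lipschitz_on (ball vbar \<tau>) p" and v: "v \<in> ball vbar \<tau>"
  shows "has_gradient (envelope \<phi> lam f) v ((1 / lam) *\<^sub>R gradient \<phi> (v - p v))"
proof -
  let ?e = "\<lambda>v. real_of_ereal (envelope \<phi> lam f v)"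
  let ?D = "\<lambda>v. (1 / lam) *\<^sub>R gradient \<phi> (v - p v)"
  have K: "0 \<le> K" using lip by (rule lipschitz_on_nonneg)
  have near: "\<forall>\<^sub>F u in nhds v. u \<in> ball vbar \<tau>"
    using v by (intro eventually_nhds_in_open) auto
  have b: "norm (u - vbar) < \<eta>" "p u \<in> P u" if "u \<in> ball vbar \<tau>" for u
    using that \<tau> p by (auto simp: dist_norm norm_minus_commute)
  show ?thesis
  proof (rule has_gradientI_quadratic[where C = "L * (2 + K) / lam"])
    show "\<forall>\<^sub>F u in nhds v. \<bar>envelope \<phi> lam f u\<bar> \<noteq> \<infinity>"
      using near
    proof (rule eventually_mono)
      fix u assume u: "u \<in> ball vbar \<tau>"
      note n = prox_near[OF b[OF u]]
      have "envelope \<phi> lam f u = ereal (F (p u) + \<Phi> (u - p u) / lam)"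
        unfolding envelope_prox[OF b(2)[OF u]] obj_real[OF n(3)] by (subst n(2)) simp
      then show "\<bar>envelope \<phi> lam f u\<bar> \<noteq> \<infinity>" by simp
    qed
    show "\<forall>\<^sub>F u in nhds v. \<bar>?e u - ?e v - inner (?D v) (u - v)\<bar> \<le> L * (2 + K) / lam * (norm (u - v))\<^sup>2"
      using near
    proof (rule eventually_mono)
      fix u assume u: "u \<in> ball vbar \<tau>"
      have up: "?e u - ?e v \<le> inner (?D v) (u - v) + L / lam * (norm (u - v))\<^sup>2"
        by (rule envelope_increment[OF b(1)[OF u] b[OF v] b(2)[OF u]])
      have lo: "?e v - ?e u \<le> inner (?D u) (v - u) + L / lam * (norm (v - u))\<^sup>2"
        by (rule envelope_increment[OF b(1)[OF v] b[OF u] b(2)[OF v]])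
      have "norm (?D u - ?D v) \<le> L * (1 + K) / lam * norm (u - v)"
        using lipschitz_onD[OF gradient_envelope_lipschitz[OF \<tau> p lip] u v] by (simp add: dist_norm)
      then have "inner (?D v - ?D u) (u - v) \<le> L * (1 + K) / lam * norm (u - v) * norm (u - v)"
        by (intro order_trans[OF norm_cauchy_schwarz] mult_right_mono) (auto simp: norm_minus_commute)
      moreover have "inner (?D u) (v - u) = inner (?D v - ?D u) (u - v) - inner (?D v) (u - v)"
        by (simp add: inner_diff_left inner_diff_right)
      moreover have "L * (2 + K) / lam * (norm (u - v))\<^sup>2
          = L / lam * (norm (u - v))\<^sup>2 + L * (1 + K) / lam * norm (u - v) * norm (u - v)"
        by (simp add: algebra_simps add_divide_distrib power2_eq_square)
      moreover have "0 \<le> L * (1 + K) / lam * norm (u - v) * norm (u - v)"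
        using pos sizes K by simp
      ultimately show "\<bar>?e u - ?e v - inner (?D v) (u - v)\<bar> \<le> L * (2 + K) / lam * (norm (u - v))\<^sup>2"
        using up lo unfolding norm_minus_commute[of v u] abs_le_iff by linarith
    qed
  qed
qed

lemma single_valued_lipschitz_prox: "single_valued_lipschitz_near (prox \<phi> lam f) vbar"
proof -
  obtain \<tau> p where "0 < \<tau>" "\<tau> \<le> \<eta>" "\<forall>v\<in>ball vbar \<tau>. P v = {p v}"
    "(L / (\<sigma> - lam * r))-lipschitz_on (ball vbar \<tau>) p"
    using prox_selection .
  then show ?thesis
    unfolding single_valued_lipschitz_near_def
    by (intro exI[of _ "ball vbar \<tau>"] exI[of _ p] exI[of _ "L / (\<sigma> - lam * r)"]) simp
qed

lemma envelope_lipschitz_differentiable: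
  "lipschitz_differentiable_around (envelope \<phi> lam f) vbar"
  "\<forall>\<^sub>F v in nhds vbar. \<exists>z. P v = {z} \<and>
     gradient (envelope \<phi> lam f) v = (1 / lam) *\<^sub>R gradient \<phi> (v - z)"
proof -
  obtain \<tau> p where \<tau>: "0 < \<tau>" "\<tau> \<le> \<eta>" and p: "\<forall>v\<in>ball vbar \<tau>. P v = {p v}"
    and lip: "(L / (\<sigma> - lam * r))-lipschitz_on (ball vbar \<tau>) p"
    using prox_selection .
  let ?D = "\<lambda>v. (1 / lam) *\<^sub>R gradient \<phi> (v - p v)"
  have D: "has_gradient (envelope \<phi> lam f) v (?D v)" if "v \<in> ball vbar \<tau>" for v
    by (rule has_gradient_envelope[OF \<tau>(2) p[rule_format] lip that])
  have D': "ediff_at (envelope \<phi> lam f) v" if "v \<in> ball vbar \<tau>" for v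
    unfolding ediff_at_def using D[OF that] by blast
  have G: "gradient (envelope \<phi> lam f) v = ?D v" if "v \<in> ball vbar \<tau>" for v
    by (rule gradient_eq[OF D[OF that]])
  obtain M where "M-lipschitz_on (ball vbar \<tau>) ?D"
    using gradient_envelope_lipschitz[OF \<tau>(2) p[rule_format] lip] by blast
  then have "M-lipschitz_on (ball vbar \<tau>) (gradient (envelope \<phi> lam f))"
    by (rule lipschitz_on_transform) (simp add: G)
  then show "lipschitz_differentiable_around (envelope \<phi> lam f) vbar"
    unfolding lipschitz_differentiable_around_def
    using \<tau>(1) D' by (intro exI[of _ "ball vbar \<tau>"]) auto
  have "\<forall>\<^sub>F v in nhds vbar. v \<in> ball vbar \<tau>"
    using \<tau>(1) by (intro eventually_nhds_in_open) auto
  then show "\<forall>\<^sub>F v in nhds vbar. \<exists>z. P v = {z} \<and>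
     gradient (envelope \<phi> lam f) v = (1 / lam) *\<^sub>R gradient \<phi> (v - z)"
    by (rule eventually_mono) (use p G in blast)
qed

end

section \<open>Small parameters\<close>

text \<open>A lower bound for the envelope with the fixed parameter \<open>lam1\<close> reads
  \<open>b \<le> f z + \<phi> (v - z) / lam1\<close>.  For the smaller parameter \<open>lam\<close> the surplus
  \<open>(1 / lam - 1 / lam1) * \<phi> (v - z)\<close> remains, and the kernel is at least \<open>\<sigma> * \<delta>\<^sup>2 / 8\<close> outside the ball
  of radius \<open>\<delta> / 2\<close>.\<close>

lemma (in local_kernel) far_points_not_optimal:
  assumes bounded: "ereal b \<le> envelope \<phi> lam1 f v" and f: "f z > -\<infinity>" and a: "f zbar = ereal a"
    and lam: "0 < lam" "1 / lam1 \<le> 1 / lam"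
    and gap: "a + M * (\<delta> / 2) - b < (1 / lam - 1 / lam1) * (\<sigma> * \<delta>\<^sup>2 / 8)"
    and \<delta>: "0 < \<delta>" "\<delta> < \<rho>"
    and v: "norm (v - zbar) \<le> \<delta> / 2" "norm (gradient \<phi> (v - zbar)) \<le> lam * M"
    and z: "\<delta> \<le> norm (z - zbar)"
  shows "f zbar + ereal (1 / lam) * \<phi> (v - zbar) < f z + ereal (1 / lam) * \<phi> (v - z)"
proof -
  have w: "norm (v - zbar) < \<rho>" using v(1) \<delta> by linarith
  have "\<Phi> (v - zbar) \<le> inner (gradient \<phi> (v - zbar)) (v - zbar)"
    using gradient_inequality_real[OF w, of 0] pos by (simp add: kernel_0 inner_diff_right)
  also have "\<dots> \<le> lam * M * (\<delta> / 2)"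
    by (intro order_trans[OF norm_cauchy_schwarz] mult_mono v) (use norm_ge_zero v order_trans in blast)+
  finally have "\<Phi> (v - zbar) / lam \<le> lam * M * (\<delta> / 2) / lam"
    using lam by (intro divide_right_mono) auto
  then have left: "a + \<Phi> (v - zbar) / lam \<le> a + M * (\<delta> / 2)" using lam by simp
  have zv: "\<delta> / 2 \<le> norm (v - z)"
    using norm_triangle_ineq4[of "v - zbar" "v - z"] v(1) z by simp
  have growth: "ereal (\<sigma> * (\<delta> / 2) / 2 * norm (v - z)) \<le> \<phi> (v - z)"
    by (rule kernel_growth) (use \<delta> zv in auto)
  have LHS: "f zbar + ereal (1 / lam) * \<phi> (v - zbar) = ereal (a + \<Phi> (v - zbar) / lam)"
    by (subst kernel_real[OF w]) (simp add: a)
  show ?thesis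
  proof (cases "\<phi> (v - z) = \<infinity> \<or> f z = \<infinity>")
    case True
    moreover have "ereal (1 / lam) * \<phi> (v - z) \<noteq> -\<infinity>"
      using kernel_nonneg[of "v - z"] lam by (cases "\<phi> (v - z)") auto
    ultimately have inf: "f z + ereal (1 / lam) * \<phi> (v - z) = \<infinity>" using lam f by auto
    show ?thesis unfolding LHS inf by simp
  next
    case False
    then obtain q t where q: "\<phi> (v - z) = ereal q" and t: "f z = ereal t"
      using kernel_nonneg[of "v - z"] f by (cases "\<phi> (v - z)"; cases "f z") auto
    have "ereal b \<le> f z + ereal (1 / lam1) * \<phi> (v - z)"
      using bounded unfolding envelope_def by (rule order_trans) (intro INF_lower, simp)
    then have b: "b \<le> t + q / lam1" by (simp add: q t)
    have "\<sigma> * \<delta>\<^sup>2 / 8 = \<sigma> * (\<delta> / 2) / 2 * (\<delta> / 2)" by (simp add: power2_eq_square)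
    also have "\<dots> \<le> \<sigma> * (\<delta> / 2) / 2 * norm (v - z)"
      using zv pos \<delta> by (intro mult_left_mono) auto
    also have "\<dots> \<le> q" using growth by (simp add: q)
    finally have "(1 / lam - 1 / lam1) * (\<sigma> * \<delta>\<^sup>2 / 8) \<le> (1 / lam - 1 / lam1) * q"
      using lam by (intro mult_left_mono) auto
    also have "\<dots> = q / lam - q / lam1" by (simp add: left_diff_distrib)
    finally have "a + M * (\<delta> / 2) - b < q / lam - q / lam1" using gap by (rule less_le_trans[rotated])
    with left b have "a + \<Phi> (v - zbar) / lam < t + q / lam" by linarith
    then show ?thesis unfolding LHS by (simp add: q t)
  qed
qed

theorem theorem4p3:
  fixes \<phi> f :: "real^'n \<Rightarrow> ereal" and zbar ybar :: "real^'n"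
  assumes A1: "proper \<phi>" "lsc \<phi>" "econvex \<phi>" "legendre \<phi>"
    and A2: "open (edom \<phi>)"
    and A3: "C2_pos_def_Hessian \<phi>"
    and A4: "super_coercive \<phi>"
    and A5: "\<phi> 0 = 0" "has_gradient \<phi> 0 0"
    and f: "proper f" "lsc f" "prox_bounded \<phi> f"
    and reg: "prox_regular f zbar ybar"
  shows "\<exists>lam0>0. \<forall>lam vbar.
    0 < lam \<and> lam < lam0 \<and> ereal lam < prox_threshold \<phi> f \<and>
    vbar \<in> (\<lambda>w. zbar + w) ` edom \<phi> \<and>
    ybar = (1 / lam) *\<^sub>R gradient \<phi> (vbar - zbar) \<longrightarrow>
      (single_valued_lipschitz_near (prox \<phi> lam f) vbar \<and>
       prox \<phi> lam f vbar = {zbar} \<and>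
       (\<exists>\<epsilon>>0. \<forall>\<^sub>F v in nhds vbar.
          prox \<phi> lam f v =
            set_valued_inverse
              (id_plus_grad_conj \<phi> lam (attentive_localization f zbar ybar \<epsilon>)) v))
      \<and>
      (lipschitz_differentiable_around (envelope \<phi> lam f) vbar \<and>
       (\<forall>\<^sub>F v in nhds vbar. \<exists>z. prox \<phi> lam f v = {z} \<and>
          gradient (envelope \<phi> lam f) v = (1 / lam) *\<^sub>R gradient \<phi> (v - z)))"
proof -
  obtain \<rho> \<sigma> L where "local_kernel \<phi> \<rho> \<sigma> L"
    using local_kernel_exists[OF A1(1,3) A3 A5] .
  then interpret local_kernel \<phi> \<rho> \<sigma> L .
  have finite_zbar: "\<bar>f zbar\<bar> \<noteq> \<infinity>" and ybar: "ybar \<in> limiting_subdiff f zbar"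
    using reg by (simp_all add: prox_regular_def)
  obtain e r where e: "0 < e" and r: "0 \<le> r" and all:
    "\<forall>z'. norm (z' - zbar) < e \<longrightarrow>
      (\<forall>z y. norm (z - zbar) < e \<and> f z - f zbar < ereal e \<and>
        y \<in> limiting_subdiff f z \<and> norm (y - ybar) < e \<longrightarrow>
        f z + ereal (inner y (z' - z)) - ereal (r / 2 * (norm (z' - z))\<^sup>2) \<le> f z')"
    using reg unfolding prox_regular_def by (elim conjE exE)
  note regular = all[rule_format, OF _ conjI[OF _ conjI[OF _ conjI]]]
  obtain a where a: "f zbar = ereal a" using finite_zbar by (cases "f zbar") auto
  obtain lam1 \<kappa> \<beta> where lam1: "0 < lam1" and \<kappa>: "0 < \<kappa>" and \<beta>: "\<beta> > -\<infinity>"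
    and bounded: "\<And>v. norm (v - zbar) \<le> \<kappa> \<Longrightarrow> \<beta> \<le> envelope \<phi> lam1 f v"
    using f(3) unfolding prox_bounded_def prox_bounded_with_def by blast
  obtain b where b: "ereal b \<le> \<beta>" using \<beta> by (cases \<beta>) auto
  \<comment> \<open>The constants below do not involve \<open>lam\<close> or \<open>vbar\<close>: \<open>\<tau>\<close> will bound \<open>norm (vbar - zbar)\<close>, \<open>M\<close> the
    norm of \<open>gradient \<phi> (v - zbar) / lam\<close>, and \<open>c\<close> the kernel from below far from the origin.\<close>
  define \<delta> where "\<delta> = min e (\<rho> / 4)"
  define \<tau> where "\<tau> = min (\<delta> / 4) (\<kappa> / 2)"
  define M where "M = norm ybar + 1"
  define c where "c = \<sigma> * \<delta>\<^sup>2 / 8"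
  define C where "C = \<bar>a + M * (\<delta> / 2) - b\<bar> + 1"
  \<comment> \<open>The three bounds yield, in this order, \<open>lam * r < \<sigma>\<close>, the closeness of \<open>vbar\<close> to \<open>zbar\<close>, and the
    surplus over the fixed parameter \<open>lam1\<close> that excludes distant minimizers.\<close>
  define lam0 where "lam0 = Min {\<sigma> / (r + 1), \<sigma> * \<tau> / (2 * M), 1 / (1 / lam1 + C / c)}"
  have \<delta>: "0 < \<delta>" "\<delta> \<le> e" "4 * \<delta> \<le> \<rho>" using e pos by (auto simp: \<delta>_def)
  have \<tau>: "0 < \<tau>" "4 * \<tau> \<le> \<delta>" "2 * \<tau> \<le> \<kappa>" using \<delta> \<kappa> by (auto simp: \<tau>_def)
  have M: "0 < M" unfolding M_def by (simp add: add_nonneg_pos)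
  have c: "0 < c" using pos \<delta> by (simp add: c_def)
  have C: "0 < C" by (simp add: C_def add_nonneg_pos)
  have recip: "0 < 1 / lam1 + C / c" using lam1 c C by (simp add: add_pos_pos)
  have lam0: "0 < lam0" using pos r \<tau> M recip by (simp add: lam0_def)
  show ?thesis
  proof (intro exI[of _ lam0] conjI[OF lam0] allI impI, elim conjE imageE, intro conjI)
    fix lam :: real and vbar w :: "real^'n"
    assume lam: "0 < lam" "lam < lam0" and w: "vbar = zbar + w" "w \<in> edom \<phi>"
      and yb: "ybar = (1 / lam) *\<^sub>R gradient \<phi> (vbar - zbar)"
    have l: "lam < \<sigma> / (r + 1)" "lam < \<sigma> * \<tau> / (2 * M)" "lam < 1 / (1 / lam1 + C / c)"
      using lam(2) by (auto simp: lam0_def)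
    have "lam * (r + 1) < \<sigma>" using l(1) r by (simp add: pos_less_divide_eq)
    then have lr: "lam * r < \<sigma>" using lam(1) by (simp add: algebra_simps)
    have "lam * M < \<sigma> * \<tau> / 2" using l(2) M by (simp add: field_simps)
    then have ly: "lam * norm ybar < \<sigma> * \<tau> / 2" using lam(1) by (simp add: M_def algebra_simps)
    have lc: "1 / lam1 + C / c < 1 / lam"
      using l(3) lam(1) recip by (simp add: field_simps)
    have grad: "gradient \<phi> (vbar - zbar) = lam *\<^sub>R ybar" using yb lam(1) by simp
    have "has_gradient \<phi> (vbar - zbar) (lam *\<^sub>R ybar)"
      unfolding grad[symmetric] using A3 A2 w
      by (intro has_gradient_gradient) (simp add: C2_pos_def_Hessian_def interior_open)
    \<comment> \<open>As \<open>ybar\<close> is fixed, \<open>gradient \<phi> (vbar - zbar) = lam *\<^sub>R ybar\<close> is small, and hence so is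
      \<open>vbar - zbar\<close>.\<close>
    then have vz: "norm (vbar - zbar) < \<tau>"
      by (rule norm_less_if_gradient_small) (use \<tau> \<delta> ly lam(1) in auto)
    \<comment> \<open>Within distance \<open>lam / (L + 1)\<close> of \<open>vbar\<close> the gradient of the kernel varies by at most \<open>lam\<close>.\<close>
    define \<eta> where "\<eta> = min \<tau> (lam / (L + 1))"
    have "\<eta> \<le> lam / (L + 1)" by (simp add: \<eta>_def)
    then have "(L + 1) * \<eta> \<le> lam" using pos by (simp add: pos_le_divide_eq mult.commute)
    moreover have "0 < \<eta>" "\<eta> \<le> \<tau>" using \<tau> lam(1) pos by (simp_all add: \<eta>_def)
    ultimately have \<eta>: "0 < \<eta>" "\<eta> \<le> \<tau>" "(L + 1) * \<eta> \<le> lam" by blast+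
    have gap: "a + M * (\<delta> / 2) - b < (1 / lam - 1 / lam1) * (\<sigma> * \<delta>\<^sup>2 / 8)"
    proof -
      have "C / c * c < (1 / lam - 1 / lam1) * c"
        using lc c by (intro mult_strict_right_mono) auto
      then show ?thesis using c unfolding C_def c_def[symmetric] by simp
    qed
    interpret prox_setting \<phi> \<rho> \<sigma> L f zbar ybar vbar lam \<delta> r \<eta>
    proof
      show "f z + ereal (inner y (z' - z)) - ereal (r / 2 * (norm (z' - z))\<^sup>2) \<le> f z'"
        if "norm (z - zbar) < \<delta>" "f z < f zbar + ereal \<delta>" "y \<in> limiting_subdiff f z"
          "norm (y - ybar) < \<delta>" "norm (z' - zbar) < \<delta>" for z y z'
      proof (rule regular)
        show "f z - f zbar < ereal e" using that(2) \<delta>(2) by (cases "f z") (auto simp: a)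
      qed (use that \<delta> in auto)
      show "f zbar + ereal (1 / lam) * \<phi> (v - zbar) < f z + ereal (1 / lam) * \<phi> (v - z)"
        if v: "norm (v - vbar) < \<eta>" and z: "\<delta> \<le> norm (z - zbar)" for v z
      proof (rule far_points_not_optimal[where M = M])
        have vn: "norm (v - zbar) < 2 * \<tau>"
          using norm_triangle_ineq[of "v - vbar" "vbar - zbar"] v vz \<eta> by simp
        then show "norm (v - zbar) \<le> \<delta> / 2" using \<tau> by simp
        show "ereal b \<le> envelope \<phi> lam1 f v"
          using vn \<tau> by (intro order_trans[OF b bounded]) simp
        have "norm (gradient \<phi> (v - zbar) - gradient \<phi> (vbar - zbar)) \<le> L * norm (v - vbar)"
          using gradient_lipschitz[of "v - zbar" "vbar - zbar"] vn vz \<tau> \<delta> by simp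
        also have "\<dots> \<le> (L + 1) * \<eta>" using v pos by (intro mult_mono) auto
        finally have "norm (gradient \<phi> (v - zbar) - lam *\<^sub>R ybar) \<le> lam" using \<eta>(3) grad by simp
        moreover have "norm (gradient \<phi> (v - zbar)) \<le> norm (lam *\<^sub>R ybar)
            + norm (gradient \<phi> (v - zbar) - lam *\<^sub>R ybar)"
          using norm_triangle_ineq[of "lam *\<^sub>R ybar" "gradient \<phi> (v - zbar) - lam *\<^sub>R ybar"] by simp
        ultimately show "norm (gradient \<phi> (v - zbar)) \<le> lam * M"
          using lam(1) by (simp add: M_def algebra_simps)
        show "1 / lam1 \<le> 1 / lam" using lc C c by (smt (verit) divide_pos_pos)
        show "f z > -\<infinity>" using f(1) by (simp add: proper_def)
      qed (use a lam gap \<delta> z pos in auto)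
      have "\<sigma> * \<tau> / 2 \<le> \<sigma> * \<delta> / 2" using pos \<tau> by simp
      with ly show "lam * norm ybar < \<sigma> * \<delta> / 2" by linarith
    qed (use f finite_zbar ybar \<delta> \<tau> \<eta> lam lr grad vz in auto)
    show "single_valued_lipschitz_near (prox \<phi> lam f) vbar"
      by (rule single_valued_lipschitz_prox)
    show "prox \<phi> lam f vbar = {zbar}" by (rule prox_vbar)
    show "\<exists>\<epsilon>>0. \<forall>\<^sub>F v in nhds vbar. prox \<phi> lam f v =
        set_valued_inverse (id_plus_grad_conj \<phi> lam (attentive_localization f zbar ybar \<epsilon>)) v"
      by (rule prox_eq_inverse)
    show "lipschitz_differentiable_around (envelope \<phi> lam f) vbar"
      by (rule envelope_lipschitz_differentiable(1))
    show "\<forall>\<^sub>F v in nhds vbar. \<exists>z. prox \<phi> lam f v = {z} \<and>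
         gradient (envelope \<phi> lam f) v = (1 / lam) *\<^sub>R gradient \<phi> (v - z)"
      by (rule envelope_lipschitz_differentiable(2))
  qed
qed

end
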